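(* Let $\Phi=(G,\varphi)$ be a $\mathbb{T}$-gain graph on a connected simple graph $G$ with vertex set $\{v_1,\dots,v_n\}$ and at least one edge. Then $$\mathcal{E}_{\Phi}(v_i)\geq \frac{d(v_i)}{\rho(G)}\qquad\text{for all } v_i\in V(G).$$ Moreover, equality $\mathcal{E}_{\Phi}(v_i)=\frac{d(v_i)}{\rho(G)}$ holds for all vertices $v_i$ if and only if $\Phi$ is balanced and $G$ is a complete bipartite graph.
   Context: Let $\mathbb{T}=\{z\in\mathbb{C}:|z|=1\}$. For a simple graph $G$, let $\vec{E}(G)$ consist of both orientations $\vec{e}_{p,q},\vec{e}_{q,p}$ of each edge $e_{p,q}$. A $\mathbb{T}$-gain graph $\Phi=(G,\varphi)$ is a graph $G$ with a map $\varphi:\vec{E}(G)\to\mathbb{T}$ with $\varphi(\vec{e}_{p,q})=\varphi(\vec{e}_{q,p})^{-1}$. Its adjacency matrix $A(\Phi)=(a_{p,q})$ is the Hermitian matrix with $a_{p,q}=\varphi(\vec{e}_{p,q})$ if $v_p\sim v_q$ and $0$ otherwise. For a cycle $C: v_1\sim v_2\sim\cdots\sim v_k\sim v_1$, its gain is $\varphi(\vec C)=\varphi(\vec e_{1,2})\varphi(\vec e_{2,3})\cdots\varphi(\vec e_{k,1})$; $\Phi$ is balanced if $\varphi(\vec C)=1$ for every cycle $C$ of $G$. The energy of the vertex $v_i$ in $\Phi$ is $\mathcal{E}_\Phi(v_i)=\big((A(\Phi)A(\Phi)^* )^{1/2}\big)_{ii}$. $d(v_i)$ is the degree of $v_i$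 in $G$, and $\rho(G)$ is the spectral radius of the ordinary (0/1) adjacency matrix of $G$. *)

theory Defs
  imports "Graph_Theory.Graph_Theory" "Jordan_Normal_Form.Spectral_Radius"
    "Jordan_Normal_Form.Schur_Decomposition"
begin

text \<open>
  A simple graph is a \<^locale>\<open>pair_graph\<close>: a finite, loop-free, symmetric set of pairs of
  vertices. Hence \<open>parcs G\<close> consists of both orientations of every edge.
\<close>

locale gain_graph = pair_graph G for G :: "'a pair_pre_digraph" +
  fixes \<phi> :: "'a \<times> 'a \<Rightarrow> complex"
  assumes gain_unit: "\<And>e. e \<in> parcs G \<Longrightarrow> norm (\<phi> e) = 1"
    and gain_inverse: "\<And>p q. (p, q) \<in> parcs G \<Longrightarrow> \<phi> (p, q) = inverse (\<phi> (q, p))"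

text \<open>
  The list \<open>vs\<close> enumerates the vertices (without repetition) and so indexes rows and columns,
  starting from 0.
\<close>

definition gain_adj_mat :: "'a pair_pre_digraph \<Rightarrow> ('a \<times> 'a \<Rightarrow> complex) \<Rightarrow> 'a list \<Rightarrow> complex mat" where
  "gain_adj_mat G \<phi> vs = mat (length vs) (length vs)
     (\<lambda>(i, j). if (vs ! i, vs ! j) \<in> parcs G then \<phi> (vs ! i, vs ! j) else 0)"

definition adj_mat :: "'a pair_pre_digraph \<Rightarrow> 'a list \<Rightarrow> complex mat" where
  "adj_mat G vs = mat (length vs) (length vs)
     (\<lambda>(i, j). if (vs ! i, vs ! j) \<in> parcs G then 1 else 0)"

definition graph_spectral_radius :: "'a pair_pre_digraph \<Rightarrow> 'a list \<Rightarrow> real" where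
  "graph_spectral_radius G vs = spectral_radius (adj_mat G vs)"

text \<open>
  Arc walks such as \<open>[(u, v), (v, u)]\<close> are cycles of the symmetric digraph, but not of the
  undirected graph, hence the bound on the length.
\<close>

definition graph_cycle :: "'a pair_pre_digraph \<Rightarrow> ('a \<times> 'a) list \<Rightarrow> bool" where
  "graph_cycle G c \<longleftrightarrow> pre_digraph.cycle (with_proj G) c \<and> 3 \<le> length c"

definition cycle_gain :: "('a \<times> 'a \<Rightarrow> complex) \<Rightarrow> ('a \<times> 'a) list \<Rightarrow> complex" where
  "cycle_gain \<phi> c = prod_list (map \<phi> c)"

definition balanced :: "'a pair_pre_digraph \<Rightarrow> ('a \<times> 'a \<Rightarrow> complex) \<Rightarrow> bool" where
  "balanced G \<phi> \<longleftrightarrow> (\<forall>c. graph_cycle G c \<longrightarrow> cycle_gain \<phi> c = 1)"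

definition complete_bipartite_graph :: "'a pair_pre_digraph \<Rightarrow> bool" where
  "complete_bipartite_graph G \<longleftrightarrow>
     (\<exists>a b. 0 < a \<and> 0 < b \<and> complete_bipartite_digraph a b (with_proj G))"

text \<open>The quadratic form of a Hermitian matrix is real, so taking real parts loses nothing.\<close>

definition pos_semidef :: "complex mat \<Rightarrow> bool" where
  "pos_semidef B \<longleftrightarrow> square_mat B \<and> mat_adjoint B = B \<and>
     (\<forall>x \<in> carrier_vec (dim_row B). 0 \<le> Re ((B *\<^sub>v x) \<bullet>c x))"

text \<open>
  Every positive semidefinite matrix has exactly one positive semidefinite square root;
  the definite description is only meaningful for such matrices.
\<close>

definition psd_sqrt :: "complex mat \<Rightarrow> complex mat" where
  "psd_sqrt M = (THE B. B \<in> carrier_mat (dim_row M) (dim_row M) \<and> pos_semidef B \<and> B * B = M)"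

text \<open>Diagonal entries of a Hermitian matrix are real, so again the real part loses nothing.\<close>

definition vertex_energy :: "'a pair_pre_digraph \<Rightarrow> ('a \<times> 'a \<Rightarrow> complex) \<Rightarrow> 'a list \<Rightarrow> nat \<Rightarrow> real" where
  "vertex_energy G \<phi> vs i =
     Re (psd_sqrt (gain_adj_mat G \<phi> vs * mat_adjoint (gain_adj_mat G \<phi> vs)) $$ (i, i))"

text \<open>In a symmetric digraph the number of outgoing arcs of a vertex is its undirected degree.\<close>

definition vertex_degree :: "'a pair_pre_digraph \<Rightarrow> 'a \<Rightarrow> nat" where
  "vertex_degree G v = out_degree (with_proj G) v"

end

theory Submission
  imports Defs
begin

text \<open>
  Write \<open>A\<close> for the gain matrix, \<open>B\<close> for the 0/1 adjacency matrix and \<open>\<rho>\<close> for the spectral radius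
  of \<open>B\<close>. All eigenvalues \<open>d\<^sub>k\<close> of \<open>A\<close> satisfy \<open>\<bar>d\<^sub>k\<bar> \<le> \<rho>\<close>, so with orthonormal eigenvectors \<open>u\<^sub>k\<close> the
  degree \<open>(A\<^sup>2)\<^sub>i\<^sub>i = \<Sum>\<^sub>k d\<^sub>k\<^sup>2 \<bar>u\<^sub>i\<^sub>k\<bar>\<^sup>2\<close> is at most \<open>\<rho> \<Sum>\<^sub>k \<bar>d\<^sub>k\<bar> \<bar>u\<^sub>i\<^sub>k\<bar>\<^sup>2\<close>, that is, \<open>\<rho>\<close> times the
  energy. Equality at every vertex forces \<open>d\<^sub>k \<in> {0, \<rho>, -\<rho>}\<close>, i.e. \<open>A\<^sup>3 = \<rho>\<^sup>2 A\<close>. Comparing entries with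
  those of \<open>B\<^sup>3\<close>, this says that the ends of every walk of length 3 are joined by an arc with the same
  gain as the walk. By induction the same holds for all walks of odd length. Hence no closed walk is
  odd, vertices at odd distance are adjacent, and closed walks have gain 1. Conversely, for balanced
  \<open>K\<^bsub>a,b\<^esub>\<close> we have \<open>A\<^sup>3 = ab A\<close> and \<open>\<rho>\<^sup>2 = ab\<close>, so that \<open>A\<^sup>2 / \<rho>\<close> is the positive square root of \<open>A\<^sup>2\<close>.
\<close>

section \<open>Diagonalization of Hermitian matrices\<close>

lemma mat_adjoint_dim [simp]:
  "dim_row (mat_adjoint A) = dim_col A" "dim_col (mat_adjoint A) = dim_row A"
  by (simp_all add: mat_adjoint_def)

lemma mat_adjoint_carrier [simp, intro]:
  "A \<in> carrier_mat m n \<Longrightarrow> mat_adjoint A \<in> carrier_mat n m"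
  by auto

lemma mat_adjoint_index [simp]:
  "i < dim_col A \<Longrightarrow> j < dim_row A \<Longrightarrow> mat_adjoint A $$ (i, j) = conjugate (A $$ (j, i))"
  by (simp add: mat_adjoint_def mat_of_rows_index)

lemma mat_adjoint_mat_adjoint [simp]: "mat_adjoint (mat_adjoint A) = A"
  by (rule eq_matI) auto

lemma index_mult_mat_sum:
  "A \<in> carrier_mat m n \<Longrightarrow> B \<in> carrier_mat n p \<Longrightarrow> i < m \<Longrightarrow> j < p \<Longrightarrow>
    (A * B) $$ (i, j) = (\<Sum>k<n. A $$ (i, k) * B $$ (k, j))"
  by (auto simp: scalar_prod_def lessThan_atLeast0 intro!: sum.cong)

lemma index_mult_mat_vec_sum:
  "A \<in> carrier_mat m n \<Longrightarrow> x \<in> carrier_vec n \<Longrightarrow> i < m \<Longrightarrow>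
    (A *\<^sub>v x) $ i = (\<Sum>k<n. A $$ (i, k) * x $ k)"
  by (auto simp: scalar_prod_def lessThan_atLeast0 intro!: sum.cong)

lemma cscalar_prod_sum:
  "x \<in> carrier_vec n \<Longrightarrow> y \<in> carrier_vec n \<Longrightarrow> x \<bullet>c y = (\<Sum>k<n. x $ k * conjugate (y $ k))"
  by (auto simp: scalar_prod_def lessThan_atLeast0 intro!: sum.cong)

lemma cscalar_prod_self:
  fixes x :: "complex vec"
  shows "x \<in> carrier_vec n \<Longrightarrow> x \<bullet>c x = of_real (\<Sum>k<n. (cmod (x $ k))\<^sup>2)"
  by (simp add: cscalar_prod_sum complex_norm_square del: of_real_power)

lemma mat_adjoint_mult:
  fixes A B :: "complex mat"
  assumes "A \<in> carrier_mat m n" "B \<in> carrier_mat n p"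
  shows "mat_adjoint (A * B) = mat_adjoint B * mat_adjoint A"
proof (rule eq_matI)
  fix i j assume "i < dim_row (mat_adjoint B * mat_adjoint A)"
    "j < dim_col (mat_adjoint B * mat_adjoint A)"
  then have ij: "i < p" "j < m" using assms by auto
  have "(mat_adjoint B * mat_adjoint A) $$ (i, j)
      = (\<Sum>k<n. mat_adjoint B $$ (i, k) * mat_adjoint A $$ (k, j))"
    using assms ij by (intro index_mult_mat_sum) auto
  also have "\<dots> = mat_adjoint (A * B) $$ (i, j)"
    using assms ij by (simp add: index_mult_mat_sum[OF assms ij(2,1)] mult.commute
        del: index_mult_mat(1))
  finally show "mat_adjoint (A * B) $$ (i, j) = (mat_adjoint B * mat_adjoint A) $$ (i, j)" ..
qed (use assms in auto)

lemma cscalar_prod_adjoint: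
  fixes A :: "complex mat"
  assumes "A \<in> carrier_mat m n" "x \<in> carrier_vec n" "y \<in> carrier_vec m"
  shows "(A *\<^sub>v x) \<bullet>c y = x \<bullet>c (mat_adjoint A *\<^sub>v y)"
proof -
  have "(A *\<^sub>v x) \<bullet>c y = (\<Sum>i<m. (A *\<^sub>v x) $ i * conjugate (y $ i))"
    using assms by (intro cscalar_prod_sum) auto
  also have "\<dots> = (\<Sum>i<m. \<Sum>k<n. A $$ (i, k) * x $ k * cnj (y $ i))"
    using assms by (simp add: index_mult_mat_vec_sum[OF assms(1,2)] sum_distrib_right
        del: index_mult_mat_vec)
  also have "\<dots> = (\<Sum>k<n. x $ k * cnj (\<Sum>i<m. cnj (A $$ (i, k)) * y $ i))"
    by (subst sum.swap) (simp add: sum_distrib_left algebra_simps)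
  also have "\<dots> = (\<Sum>k<n. x $ k * conjugate ((mat_adjoint A *\<^sub>v y) $ k))"
    using assms by (intro sum.cong refl)
      (simp add: index_mult_mat_vec_sum[of _ n m] del: index_mult_mat_vec)
  also have "\<dots> = x \<bullet>c (mat_adjoint A *\<^sub>v y)"
    using assms by (intro cscalar_prod_sum[symmetric] mult_mat_vec_carrier[of _ n m]) auto
  finally show ?thesis .
qed

section \<open>The spectral theorem for Hermitian matrices\<close>

lemma unitary_completion:
  fixes v :: "complex vec"
  assumes v: "v \<in> carrier_vec n" and v0: "v \<noteq> 0\<^sub>v n"
  obtains W c where "W \<in> carrier_mat n n" "mat_adjoint W * W = 1\<^sub>m n" "W * mat_adjoint W = 1\<^sub>m n"
    "col W 0 = c \<cdot>\<^sub>v v"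
proof -
  interpret cof_vec_space n "TYPE(complex)" .
  have n: "n > 0" using v v0 by (cases n) auto
  define ws where "ws = gram_schmidt n (basis_completion v)"
  note bc = basis_completion[OF v v0]
  note gs = gram_schmidt_result[OF bc(2) bc(4) bc(5) refl, folded ws_def]
  have len: "length ws = n" using gs(4) bc(6) by simp
  have orth: "ws ! i \<bullet>c ws ! j = 0 \<longleftrightarrow> i \<noteq> j" if "i < n" "j < n" for i j
    using gs(2) that len by (auto simp: corthogonal_def)
  have carr: "ws ! i \<in> carrier_vec n" if "i < n" for i using gs(3) len that by auto
  \<comment> \<open>Gram-Schmidt leaves the first vector as it is, so the first column of
    \<open>W\<close> will be a multiple of \<open>v\<close>.\<close>
  have "hd ws = v"
    unfolding ws_def using gram_schmidt_hd[OF v] bc(6,7) n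
    by (metis list.collapse list.size(3) less_numeral_extra(3))
  then have ws0: "ws ! 0 = v" using len n by (metis hd_conv_nth list.size(3) less_numeral_extra(3))
  define s where "s j = (\<Sum>k<n. (cmod (ws ! j $ k))\<^sup>2)" for j
  have s: "ws ! j \<bullet>c ws ! j = of_real (s j)" if "j < n" for j
    using cscalar_prod_self[OF carr[OF that]] by (simp add: s_def)
  have spos: "s j > 0" if "j < n" for j
  proof -
    have "s j \<noteq> 0" using s[OF that] orth[OF that that] by auto
    moreover have "s j \<ge> 0" unfolding s_def by (intro sum_nonneg) auto
    ultimately show ?thesis by simp
  qed
  \<comment> \<open>Gram-Schmidt delivers orthogonal vectors of arbitrary length; dividing by the
    norms \<open>sqrt (s j)\<close> makes the columns orthonormal.\<close>
  define W where "W = mat n n (\<lambda>(i, j). ws ! j $ i / of_real (sqrt (s j)))"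
  have W: "W \<in> carrier_mat n n" by (simp add: W_def)
  have WW: "mat_adjoint W * W = 1\<^sub>m n"
  proof (rule eq_matI)
    fix i j assume "i < dim_row (1\<^sub>m n :: complex mat)" "j < dim_col (1\<^sub>m n :: complex mat)"
    then have ij: "i < n" "j < n" by auto
    have "(mat_adjoint W * W) $$ (i, j) = (\<Sum>k<n. mat_adjoint W $$ (i, k) * W $$ (k, j))"
      using W ij by (intro index_mult_mat_sum) auto
    also have "\<dots> = (\<Sum>k<n. ws ! j $ k * cnj (ws ! i $ k)) / of_real (sqrt (s i) * sqrt (s j))"
      using ij W by (simp add: W_def sum_divide_distrib mult.commute)
    also have "(\<Sum>k<n. ws ! j $ k * cnj (ws ! i $ k)) = ws ! j \<bullet>c ws ! i"
      using cscalar_prod_sum[OF carr[OF ij(2)] carr[OF ij(1)]] by simp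
    also have "\<dots> / of_real (sqrt (s i) * sqrt (s j)) = (1\<^sub>m n :: complex mat) $$ (i, j)"
    proof (cases "i = j")
      case True
      have "complex_of_real (sqrt (s j)) * of_real (sqrt (s j)) = of_real (s j)"
        using spos[OF ij(2)] by (simp flip: of_real_mult)
      then show ?thesis using True s[OF ij(2)] ij spos[OF ij(2)] by simp
    next
      case False
      then show ?thesis using orth[OF ij(2,1)] ij by simp
    qed
    finally show "(mat_adjoint W * W) $$ (i, j) = (1\<^sub>m n :: complex mat) $$ (i, j)" .
  qed (use W in auto)
  show ?thesis
  proof
    show "W * mat_adjoint W = 1\<^sub>m n"
      using mat_mult_left_right_inverse[OF _ W WW] W by auto
    show "col W 0 = of_real (1 / sqrt (s 0)) \<cdot>\<^sub>v v"
      using n v by (intro eq_vecI) (auto simp: W_def ws0)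
  qed fact+
qed

text \<open>Deflation: conjugating by a unitary matrix whose first column is an eigenvector splits
  off a 1 by 1 block, and the remaining block is Hermitian of smaller size.\<close>

theorem hermitian_diagonalization:
  fixes A :: "complex mat"
  assumes "A \<in> carrier_mat n n" "mat_adjoint A = A"
  obtains U d where "U \<in> carrier_mat n n" "mat_adjoint U * U = 1\<^sub>m n" "U * mat_adjoint U = 1\<^sub>m n"
    "A = U * mat_diag n (\<lambda>k. of_real (d k)) * mat_adjoint U"
proof -
  have "\<exists>U d. U \<in> carrier_mat n n \<and> mat_adjoint U * U = 1\<^sub>m n \<and> U * mat_adjoint U = 1\<^sub>m n \<and>
    A = U * mat_diag n (\<lambda>k. of_real (d k)) * mat_adjoint U"
    using assms
  proof (induction n arbitrary: A)
    case 0
    \<comment> \<open>All matrices of size 0 coincide, so \<open>A\<close> itself serves as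
      \<open>U\<close>, with any \<open>d\<close>.\<close>
    then show ?case by (intro exI[of _ A] exI conjI eq_matI) auto
  next
    case (Suc n)
    note A = Suc.prems(1) and herm = Suc.prems(2)
    obtain e where "eigenvalue A e" using spectrum_non_empty[OF A] by (auto simp: spectrum_def)
    then obtain v where v: "v \<in> carrier_vec (Suc n)" "v \<noteq> 0\<^sub>v (Suc n)" and ev: "A *\<^sub>v v = e \<cdot>\<^sub>v v"
      using A by (auto simp: eigenvalue_def eigenvector_def)
    obtain W c where W: "W \<in> carrier_mat (Suc n) (Suc n)"
      and WW: "mat_adjoint W * W = 1\<^sub>m (Suc n)" "W * mat_adjoint W = 1\<^sub>m (Suc n)"
      and col: "col W 0 = c \<cdot>\<^sub>v v" using unitary_completion[OF v] .
    let ?W = "mat_adjoint W"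
    have W': "?W \<in> carrier_mat (Suc n) (Suc n)" using W by auto
    define B where "B = ?W * A * W"
    have B: "B \<in> carrier_mat (Suc n) (Suc n)" using A W by (auto simp: B_def)
    have Bherm: "mat_adjoint B = B"
      unfolding B_def
      using A W W' herm by (simp add: mat_adjoint_mult[of _ "Suc n" "Suc n" _ "Suc n"]
          assoc_mult_mat[of _ "Suc n" "Suc n" _ "Suc n" _ "Suc n"])
    \<comment> \<open>The first column of \<open>W\<close> is an eigenvector of \<open>A\<close>,
      and \<open>?W\<close> sends it to the first unit vector.\<close>
    have "col B 0 = ?W *\<^sub>v (A *\<^sub>v col W 0)"
      unfolding B_def using A W W'
      by (simp add: assoc_mult_mat[of _ "Suc n" "Suc n" _ "Suc n" _ "Suc n"]
          col_mult2[of _ "Suc n" "Suc n" _ "Suc n"] mult_mat_vec_def)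
    also have "A *\<^sub>v col W 0 = e \<cdot>\<^sub>v col W 0"
      unfolding col using A v ev by (simp add: mult_mat_vec smult_smult_assoc mult.commute)
    also have "?W *\<^sub>v (e \<cdot>\<^sub>v col W 0) = e \<cdot>\<^sub>v (?W *\<^sub>v col W 0)"
      using W W' by (intro mult_mat_vec[of _ "Suc n" "Suc n"] carrier_vecI) auto
    also have "?W *\<^sub>v col W 0 = col (?W * W) 0"
      using W W' by (simp add: col_mult2[of _ "Suc n" "Suc n" _ "Suc n"])
    also have "\<dots> = unit_vec (Suc n) 0" by (simp add: WW)
    finally have colB: "col B 0 = e \<cdot>\<^sub>v unit_vec (Suc n) 0" .
    have Bi0: "B $$ (i, 0) = (if i = 0 then e else 0)" if "i < Suc n" for i
      using arg_cong[OF colB, of "\<lambda>x. x $ i"] that B by auto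
    \<comment> \<open>Hermitian symmetry carries the zeros of the first column over to the first row
      and forces \<open>e\<close> to be real.\<close>
    have B0i: "B $$ (0, i) = (if i = 0 then cnj e else 0)" if "i < Suc n" for i
      using arg_cong[OF Bherm, of "\<lambda>M. M $$ (0, i)"] Bi0[OF that] that B by auto
    have ce: "cnj e = e" using Bi0[of 0] B0i[of 0] by simp
    from ce have re: "e = of_real (Re e)" by (metis Reals_cnj_iff of_real_Re)
    define C where "C = mat n n (\<lambda>(i, j). B $$ (Suc i, Suc j))"
    have C: "C \<in> carrier_mat n n" by (simp add: C_def)
    have "mat_adjoint C = C"
    proof (rule eq_matI)
      fix i j assume "i < dim_row C" "j < dim_col C"
      then have ij: "i < n" "j < n" by (auto simp: C_def)
      then show "mat_adjoint C $$ (i, j) = C $$ (i, j)"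
        using arg_cong[OF Bherm, of "\<lambda>M. M $$ (Suc i, Suc j)"] B by (simp add: C_def)
    qed (auto simp: C_def)
    from Suc.IH[OF C this] obtain V d where V: "V \<in> carrier_mat n n"
      and VV: "mat_adjoint V * V = 1\<^sub>m n" "V * mat_adjoint V = 1\<^sub>m n"
      and Cd: "C = V * mat_diag n (\<lambda>k. of_real (d k)) * mat_adjoint V" by blast
    \<comment> \<open>Block diagonal matrices multiply blockwise, so the unitary \<open>V\<close>
      and the factorization of \<open>C\<close> lift to size \<open>Suc n\<close>.\<close>
    define bl where "bl a X = four_block_mat (mat 1 1 (\<lambda>_. a)) (0\<^sub>m 1 n) (0\<^sub>m n 1) X"
      for a :: complex and X
    have bl_carr: "bl a X \<in> carrier_mat (Suc n) (Suc n)" if "X \<in> carrier_mat n n" for a X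
      using that by (auto simp: bl_def)
    have bl_mult: "bl a X * bl b Y = bl (a * b) (X * Y)"
      if "X \<in> carrier_mat n n" "Y \<in> carrier_mat n n" for a b X Y
    proof -
      have "mat 1 1 (\<lambda>_. a) * mat 1 1 (\<lambda>_. b) + 0\<^sub>m 1 n * 0\<^sub>m n 1 = mat 1 1 (\<lambda>_. a * b)"
        by (rule eq_matI) (auto simp: scalar_prod_def)
      then show ?thesis unfolding bl_def using that
        by (subst mult_four_block_mat[of _ 1 1 _ n _ n _ _ 1 _ n]) auto
    qed
    have bl_one: "bl 1 (1\<^sub>m n) = 1\<^sub>m (Suc n)"
      unfolding bl_def by (rule eq_matI) auto
    have bl_adj: "mat_adjoint (bl 1 X) = bl 1 (mat_adjoint X)" if "X \<in> carrier_mat n n" for X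
      unfolding bl_def using that by (intro eq_matI) (auto simp: less_Suc_eq_0_disj)
    have Bbl: "B = bl e C"
      unfolding bl_def using B C Bi0 B0i ce
      by (intro eq_matI) (auto simp: C_def less_Suc_eq_0_disj)
    have diag: "bl e (mat_diag n (\<lambda>k. of_real (d k)))
        = mat_diag (Suc n) (\<lambda>k. of_real (case k of 0 \<Rightarrow> Re e | Suc m \<Rightarrow> d m))"
      unfolding bl_def mat_diag_def using re
      by (intro eq_matI) (auto simp: less_Suc_eq_0_disj split: if_splits)
    define U where "U = W * bl 1 V"
    let ?V = "mat_adjoint V"
    have V': "?V \<in> carrier_mat n n" using V by auto
    note bV = bl_carr[OF V, of 1] bl_carr[OF V', of 1]
    have aU: "mat_adjoint U = bl 1 ?V * ?W"
      unfolding U_def using mat_adjoint_mult[OF W bV(1)] bl_adj[OF V] by simp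
    note assoc = assoc_mult_mat[of _ "Suc n" "Suc n" _ "Suc n" _ "Suc n"]
      mult_carrier_mat[of _ "Suc n" "Suc n" _ "Suc n"]
    have U: "U \<in> carrier_mat (Suc n) (Suc n)" using W bV by (auto simp: U_def)
    have "mat_adjoint U * U = bl 1 ?V * (?W * W) * bl 1 V"
      unfolding aU unfolding U_def using W W' bV by (simp add: assoc)
    also have "\<dots> = 1\<^sub>m (Suc n)" using bV V V' by (simp add: WW bl_mult VV bl_one)
    finally have UU: "mat_adjoint U * U = 1\<^sub>m (Suc n)" .
    have D: "mat_diag n (\<lambda>k. complex_of_real (d k)) \<in> carrier_mat n n" by simp
    have "bl e C = bl 1 V * bl e (mat_diag n (\<lambda>k. of_real (d k))) * bl 1 ?V"
      unfolding Cd using V V' D by (simp add: bl_mult)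
    note blC = this
    have "A = (W * ?W) * A * (W * ?W)" using A by (simp add: WW)
    also have "\<dots> = W * B * ?W" unfolding B_def using A W W' by (simp add: assoc)
    also have "\<dots> = U * bl e (mat_diag n (\<lambda>k. of_real (d k))) * mat_adjoint U"
      unfolding Bbl blC aU unfolding U_def using W W' bV bl_carr[OF D, of e] by (simp add: assoc)
    finally have "A = U * mat_diag (Suc n) (\<lambda>k. of_real (case k of 0 \<Rightarrow> Re e | Suc m \<Rightarrow> d m))
        * mat_adjoint U" by (simp only: diag)
    moreover have "U * mat_adjoint U = 1\<^sub>m (Suc n)"
      using mat_mult_left_right_inverse[OF _ U UU] U by auto
    ultimately show ?case using U UU by blast
  qed
  then show ?thesis using that by blast
qed

section \<open>Functional calculus and square roots\<close>

text \<open>Functional calculus in a fixed eigenbasis: if \<open>A = spectral_mat U d\<close>,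
  replacing \<open>d k\<close> by \<open>h (d k)\<close> applies \<open>h\<close> to
  \<open>A\<close>. Matrix identities thus become pointwise identities of real functions.\<close>

definition spectral_mat :: "complex mat \<Rightarrow> (nat \<Rightarrow> real) \<Rightarrow> complex mat" where
  "spectral_mat U f = U * mat_diag (dim_row U) (\<lambda>k. of_real (f k)) * mat_adjoint U"

locale unitary_mat =
  fixes U :: "complex mat" and n :: nat
  assumes carrier [simp, intro]: "U \<in> carrier_mat n n"
    and adjoint_mult: "mat_adjoint U * U = 1\<^sub>m n"
    and mult_adjoint: "U * mat_adjoint U = 1\<^sub>m n"
begin

lemma dim [simp]: "dim_row U = n" "dim_col U = n"
  by (rule carrier_matD[OF carrier])+

lemmas square_carrier = mult_carrier_mat[of _ n n _ n] mult_mat_vec_carrier[of _ n n]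

lemmas square_assoc = assoc_mult_mat[of _ n n _ n _ n] assoc_mult_mat_vec[of _ n n _ n]

lemma adjoint_carrier [simp, intro]: "mat_adjoint U \<in> carrier_mat n n"
  using carrier by (rule mat_adjoint_carrier)

lemma spectral_carrier [simp, intro]: "spectral_mat U f \<in> carrier_mat n n"
  by (auto simp: spectral_mat_def intro!: carrier_matI)

lemma spectral_dim [simp]: "dim_row (spectral_mat U f) = n" "dim_col (spectral_mat U f) = n"
  by (rule carrier_matD[OF spectral_carrier])+

lemma spectral_index:
  assumes "i < n" "j < n"
  shows "spectral_mat U f $$ (i, j) = (\<Sum>k<n. of_real (f k) * U $$ (i, k) * cnj (U $$ (j, k)))"
proof -
  have "spectral_mat U f $$ (i, j)
      = (\<Sum>k<n. (U * mat_diag n (\<lambda>k. of_real (f k))) $$ (i, k) * mat_adjoint U $$ (k, j))"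
    unfolding spectral_mat_def using assms by (simp only: dim) (intro index_mult_mat_sum, auto intro: square_carrier)
  also have "\<dots> = (\<Sum>k<n. of_real (f k) * U $$ (i, k) * cnj (U $$ (j, k)))"
    using assms by (intro sum.cong refl) (simp add: mat_diag_mult_right[of _ n n])
  finally show ?thesis .
qed

lemma spectral_cong: "(\<And>k. k < n \<Longrightarrow> f k = g k) \<Longrightarrow> spectral_mat U f = spectral_mat U g"
  by (rule eq_matI) (auto simp: spectral_index intro!: sum.cong)

lemma spectral_adjoint: "mat_adjoint (spectral_mat U f) = spectral_mat U f"
  by (rule eq_matI) (auto simp: spectral_index mult_ac intro!: sum.cong)

lemma spectral_mult: "spectral_mat U f * spectral_mat U g = spectral_mat U (\<lambda>k. f k * g k)"
proof -
  let ?D = "\<lambda>f. mat_diag n (\<lambda>k. complex_of_real (f k))" and ?V = "mat_adjoint U"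
  have "spectral_mat U f * spectral_mat U g = U * ?D f * (?V * U) * ?D g * ?V"
    unfolding spectral_mat_def by (simp add: square_assoc square_carrier del: mat_diag_diag)
  also have "\<dots> = U * (?D f * ?D g) * ?V"
    by (simp add: adjoint_mult square_assoc square_carrier right_mult_one_mat[of _ n n] del: mat_diag_diag)
  finally show ?thesis by (simp add: spectral_mat_def)
qed

lemma spectral_smult: "of_real c \<cdot>\<^sub>m spectral_mat U f = spectral_mat U (\<lambda>k. c * f k)"
  by (rule eq_matI) (auto simp: spectral_index sum_distrib_left mult.assoc)

lemma spectral_one: "spectral_mat U (\<lambda>_. 1) = 1\<^sub>m n"
  by (simp add: spectral_mat_def mult_adjoint right_mult_one_mat[of _ n n])

lemma spectral_diag:
  assumes "i < n"
  shows "spectral_mat U f $$ (i, i) = of_real (\<Sum>k<n. f k * (cmod (U $$ (i, k)))\<^sup>2)"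
  using assms by (simp add: spectral_index complex_norm_square mult.assoc del: of_real_power)

lemma col_neq_0:
  assumes "k < n"
  shows "col U k \<noteq> 0\<^sub>v n"
proof
  assume "col U k = 0\<^sub>v n"
  then have "(mat_adjoint U * U) $$ (k, k) = 0"
    using assms by (simp add: scalar_prod_def)
  then show False using assms by (simp add: adjoint_mult)
qed

lemma spectral_mult_col:
  assumes "k < n"
  shows "spectral_mat U f *\<^sub>v col U k = of_real (f k) \<cdot>\<^sub>v col U k"
proof -
  let ?D = "mat_diag n (\<lambda>k. complex_of_real (f k))"
  have "spectral_mat U f * U = U * ?D * (mat_adjoint U * U)"
    unfolding spectral_mat_def by (simp add: square_assoc square_carrier)
  also have "\<dots> = U * ?D" by (simp add: adjoint_mult right_mult_one_mat[of _ n n] square_carrier)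
  finally have eq: "spectral_mat U f * U = U * ?D" .
  have "spectral_mat U f *\<^sub>v col U k = col (spectral_mat U f * U) k"
    using assms by (simp add: col_mult2[of _ n n _ n])
  also have "\<dots> = of_real (f k) \<cdot>\<^sub>v col U k"
    unfolding eq using assms
    by (intro eq_vecI) (auto simp: mat_diag_mult_right[of _ n n] mult.commute)
  finally show ?thesis .
qed

lemma eigenvalue_spectral:
  assumes "k < n"
  shows "eigenvalue (spectral_mat U f) (of_real (f k))"
  unfolding eigenvalue_def eigenvector_def
  using assms col_neq_0 spectral_mult_col by (intro exI[of _ "col U k"]) auto

text \<open>Passing to the coordinates of \<open>x\<close> in the eigenbasis diagonalizes the
  form.\<close>

lemma spectral_quadratic_form:
  assumes x: "x \<in> carrier_vec n"
  shows "(spectral_mat U f *\<^sub>v x) \<bullet>c x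
    = of_real (\<Sum>k<n. f k * (cmod ((mat_adjoint U *\<^sub>v x) $ k))\<^sup>2)"
proof -
  let ?D = "mat_diag n (\<lambda>k. complex_of_real (f k))"
  define z where "z = mat_adjoint U *\<^sub>v x"
  have z: "z \<in> carrier_vec n" using x by (auto simp: z_def intro!: mult_mat_vec_carrier)
  have D: "?D \<in> carrier_mat n n" by simp
  have Dz: "?D *\<^sub>v z \<in> carrier_vec n" using mult_mat_vec_carrier[OF D z] .
  have Dzk: "(?D *\<^sub>v z) $ k = of_real (f k) * z $ k" if "k < n" for k
  proof -
    have "(?D *\<^sub>v z) $ k = (\<Sum>l<n. ?D $$ (k, l) * z $ l)"
      using D z that by (rule index_mult_mat_vec_sum)
    also have "\<dots> = (\<Sum>l<n. if l = k then of_real (f k) * z $ k else 0)"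
      using that by (intro sum.cong refl) (auto simp: mat_diag_def)
    finally show ?thesis using that by simp
  qed
  have "spectral_mat U f *\<^sub>v x = U *\<^sub>v (?D *\<^sub>v z)"
    unfolding spectral_mat_def z_def using x
    by (simp add: square_assoc square_carrier)
  then have "(spectral_mat U f *\<^sub>v x) \<bullet>c x = (?D *\<^sub>v z) \<bullet>c z"
    unfolding z_def using cscalar_prod_adjoint[OF carrier Dz x] by (simp add: z_def)
  also have "\<dots> = (\<Sum>k<n. of_real (f k) * (z $ k * cnj (z $ k)))"
    using cscalar_prod_sum[OF Dz z] Dzk by (simp add: mult.assoc)
  also have "\<dots> = of_real (\<Sum>k<n. f k * (cmod (z $ k))\<^sup>2)"
    by (simp add: complex_norm_square del: of_real_power)
  finally show ?thesis by (simp add: z_def)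
qed

lemma spectral_pos_semidef:
  assumes "\<And>k. k < n \<Longrightarrow> 0 \<le> f k"
  shows "pos_semidef (spectral_mat U f)"
  unfolding pos_semidef_def
  using assms by (auto simp: spectral_quadratic_form spectral_adjoint intro!: sum_nonneg)

text \<open>The diagonal entries are sums of nonnegative terms \<open>f k * |U_ik|^2\<close>, so
  each term vanishes; \<open>f k \<noteq> 0\<close> would then make column \<open>k\<close> of
  \<open>U\<close> zero. This converts information at every vertex into information on every
  eigenvalue.\<close>

lemma spectral_diag_nonpos_imp_0:
  assumes "\<And>k. k < n \<Longrightarrow> 0 \<le> f k"
    and "\<And>i. i < n \<Longrightarrow> Re (spectral_mat U f $$ (i, i)) \<le> 0"
    and k: "k < n"
  shows "f k = 0"
proof (rule ccontr)
  assume fk: "f k \<noteq> 0"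
  have "U $$ (i, k) = 0" if i: "i < n" for i
  proof -
    have "(\<Sum>k<n. f k * (cmod (U $$ (i, k)))\<^sup>2) = 0"
      using assms(2)[OF i] assms(1) by (intro antisym sum_nonneg) (auto simp: spectral_diag[OF i])
    then have "f k * (cmod (U $$ (i, k)))\<^sup>2 = 0"
      using assms(1) k by (subst (asm) sum_nonneg_eq_0_iff) auto
    then show ?thesis using fk by simp
  qed
  then have "col U k = 0\<^sub>v n" using k by (intro eq_vecI) auto
  then show False using col_neq_0[OF k] by simp
qed

end

section \<open>Eigenvalues of Hermitian matrices and uniqueness of square roots\<close>

lemma hermitian_spectral:
  fixes A :: "complex mat"
  assumes "A \<in> carrier_mat n n" "mat_adjoint A = A"
  obtains U d where "unitary_mat U n" "A = spectral_mat U d"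
proof -
  obtain U d where *: "U \<in> carrier_mat n n" "mat_adjoint U * U = 1\<^sub>m n" "U * mat_adjoint U = 1\<^sub>m n"
    "A = U * mat_diag n (\<lambda>k. of_real (d k)) * mat_adjoint U"
    using hermitian_diagonalization[OF assms] .
  show ?thesis
  proof (rule that)
    show "unitary_mat U n" using * by unfold_locales
    show "A = spectral_mat U d" unfolding spectral_mat_def using * by simp
  qed
qed

lemma hermitian_eq_0:
  fixes A :: "complex mat"
  assumes "A \<in> carrier_mat n n" "mat_adjoint A = A" "\<And>e. eigenvalue A e \<Longrightarrow> e = 0"
  shows "A = 0\<^sub>m n n"
proof -
  obtain U d where "unitary_mat U n" and A: "A = spectral_mat U d"
    using hermitian_spectral[OF assms(1,2)] .
  then interpret unitary_mat U n by simp
  have "d k = 0" if "k < n" for k using assms(3)[unfolded A, OF eigenvalue_spectral[OF that]] by simp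
  then show ?thesis unfolding A by (intro eq_matI) (auto simp: spectral_index)
qed

lemma hermitian_eigenvalue_real:
  fixes A :: "complex mat"
  assumes "A \<in> carrier_mat n n" "mat_adjoint A = A"
    and "A *\<^sub>v x = e \<cdot>\<^sub>v x" "x \<in> carrier_vec n" "x \<noteq> 0\<^sub>v n"
  shows "e \<in> \<real>"
proof -
  have "e * (x \<bullet>c x) = (A *\<^sub>v x) \<bullet>c x" using assms by simp
  also have "\<dots> = x \<bullet>c (A *\<^sub>v x)" using cscalar_prod_adjoint[OF assms(1,4,4)] assms(2) by simp
  also have "\<dots> = cnj e * (x \<bullet>c x)" using assms by (simp add: conjugate_smult_vec)
  finally show ?thesis using assms(4,5) by (simp add: Reals_cnj_iff)
qed

text \<open>
  If \<open>B - P\<close> had an eigenvector \<open>x\<close> with eigenvalue \<open>e > 0\<close>, then \<open>B x = P x + e x\<close> would be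
  strictly longer than \<open>P x\<close>, whereas \<open>B\<^sup>2 = P\<^sup>2\<close> makes them equally long.
\<close>

lemma psd_square_eq_aux:
  assumes "B \<in> carrier_mat n n" "P \<in> carrier_mat n n" "pos_semidef B" "pos_semidef P"
    and "B * B = P * P" and x: "x \<in> carrier_vec n" "x \<noteq> 0\<^sub>v n"
    and "B *\<^sub>v x = P *\<^sub>v x + of_real e \<cdot>\<^sub>v x"
  shows "e \<le> 0"
proof (rule ccontr)
  assume "\<not> e \<le> 0"
  then have e: "e > 0" by simp
  \<comment> \<open>A Hermitian \<open>M\<close> moves across the scalar product, so the length of
    \<open>M x\<close> depends only on \<open>M * M\<close>.\<close>
  have len: "(M *\<^sub>v x) \<bullet>c (M *\<^sub>v x) = ((M * M) *\<^sub>v x) \<bullet>c x"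
    if "M \<in> carrier_mat n n" "pos_semidef M" for M
  proof -
    have "M *\<^sub>v x \<in> carrier_vec n" using that x by (intro mult_mat_vec_carrier)
    then show ?thesis
      using that x cscalar_prod_adjoint[of M n n "M *\<^sub>v x" x]
      by (simp add: pos_semidef_def assoc_mult_mat_vec[of _ n n _ n])
  qed
  define y where "y = P *\<^sub>v x"
  have y: "y \<in> carrier_vec n" using assms by (auto simp: y_def intro!: mult_mat_vec_carrier)
  have ex: "of_real e \<cdot>\<^sub>v x \<in> carrier_vec n" using x by simp
  have yx: "Re (y \<bullet>c x) \<ge> 0" using assms by (auto simp: pos_semidef_def y_def)
  have "x \<bullet>c y = cnj (y \<bullet>c x)"
    using x y by (simp add: cscalar_prod_sum[of _ n] mult.commute)
  then have xy: "Re (x \<bullet>c y) \<ge> 0" using yx by simp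
  have "(y + of_real e \<cdot>\<^sub>v x) \<bullet>c (y + of_real e \<cdot>\<^sub>v x) = y \<bullet>c y"
    using len[of B] len[of P] assms by (simp add: y_def)
  moreover have "(y + of_real e \<cdot>\<^sub>v x) \<bullet>c (y + of_real e \<cdot>\<^sub>v x)
      = y \<bullet>c y + of_real e * (y \<bullet>c x) + of_real e * (x \<bullet>c y) + of_real (e\<^sup>2) * (x \<bullet>c x)"
    using x y ex by (simp add: conjugate_add_vec[of _ n] conjugate_smult_vec
        add_scalar_prod_distrib[of _ n] scalar_prod_add_distrib[of _ n]
        algebra_simps power2_eq_square)
  \<comment> \<open>All three summands have nonnegative real part, the last one even positive, so
    the sum cannot vanish.\<close>
  ultimately have "of_real e * (y \<bullet>c x) + of_real e * (x \<bullet>c y) + of_real (e\<^sup>2) * (x \<bullet>c x) = 0"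
    by (simp add: algebra_simps)
  then have "Re (of_real e * (y \<bullet>c x) + of_real e * (x \<bullet>c y) + of_real (e\<^sup>2) * (x \<bullet>c x)) = 0"
    by simp
  then have "e * Re (y \<bullet>c x) + e * Re (x \<bullet>c y) + e\<^sup>2 * Re (x \<bullet>c x) = 0"
    by (simp del: of_real_power)
  moreover have "Re (x \<bullet>c x) > 0"
    using x conjugate_square_greater_0_vec[OF x(1)] by (simp add: less_complex_def)
  ultimately show False using e xy yx
    by (smt (verit) mult_nonneg_nonneg mult_pos_pos zero_less_power)
qed

text \<open>\<open>B - P\<close> is Hermitian, so its eigenvalues are real. For an eigenvalue
  \<open>r\<close>, comparing \<open>B\<close> with \<open>P\<close> gives \<open>r \<le> 0\<close>,
  and exchanging their roles gives \<open>- r \<le> 0\<close>; a Hermitian matrix with 0 as its only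
  eigenvalue vanishes.\<close>

lemma psd_square_inj:
  assumes B: "B \<in> carrier_mat n n" and P: "P \<in> carrier_mat n n"
    and psd: "pos_semidef B" "pos_semidef P" and sq: "B * B = P * P"
  shows "B = P"
proof -
  have X: "B - P \<in> carrier_mat n n" using P by auto
  have herm: "mat_adjoint (B - P) = B - P"
  proof (rule eq_matI)
    fix i j assume "i < dim_row (B - P)" "j < dim_col (B - P)"
    then have ij: "i < n" "j < n" using P by auto
    moreover have "mat_adjoint B $$ (i, j) = B $$ (i, j)" "mat_adjoint P $$ (i, j) = P $$ (i, j)"
      using psd by (simp_all add: pos_semidef_def)
    ultimately show "mat_adjoint (B - P) $$ (i, j) = (B - P) $$ (i, j)"
      using B P by simp
  qed (use P in auto)
  have "B - P = 0\<^sub>m n n"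
  proof (rule hermitian_eq_0[OF X herm])
    fix e assume "eigenvalue (B - P) e"
    then obtain x where x: "x \<in> carrier_vec n" "x \<noteq> 0\<^sub>v n" and ev: "(B - P) *\<^sub>v x = e \<cdot>\<^sub>v x"
      using X P by (auto simp: eigenvalue_def eigenvector_def)
    obtain r where r: "e = of_real r"
      using hermitian_eigenvalue_real[OF X herm ev x] by (auto elim: Reals_cases)
    have carr: "B *\<^sub>v x \<in> carrier_vec n" "P *\<^sub>v x \<in> carrier_vec n"
      using B P x by (auto intro!: mult_mat_vec_carrier)
    have diff: "B *\<^sub>v x - P *\<^sub>v x = e \<cdot>\<^sub>v x"
      using ev B P x by (simp add: minus_mult_distrib_mat_vec[of _ n n])
    have idx: "(B *\<^sub>v x) $ i - (P *\<^sub>v x) $ i = e * x $ i" if "i < n" for i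
      using arg_cong[OF diff, of "\<lambda>v. v $ i"] that carr x P by (simp del: index_mult_mat_vec)
    have "B *\<^sub>v x = P *\<^sub>v x + of_real r \<cdot>\<^sub>v x"
      using idx carr x B P by (intro eq_vecI) (auto simp: r algebra_simps simp del: index_mult_mat_vec)
    then have "r \<le> 0" by (rule psd_square_eq_aux[OF B P psd sq x])
    moreover have "P *\<^sub>v x = B *\<^sub>v x + of_real (- r) \<cdot>\<^sub>v x"
      using idx carr x B P by (intro eq_vecI) (auto simp: r algebra_simps simp del: index_mult_mat_vec)
    then have "- r \<le> 0" by (rule psd_square_eq_aux[OF P B psd(2,1) sq[symmetric] x])
    ultimately show "e = 0" using r by simp
  qed
  then show ?thesis
    using B P by (intro eq_matI) (auto dest!: arg_cong[of _ _ "\<lambda>M. M $$ _"] simp: mat_eq_iff)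
qed

text \<open>Uniqueness of the root lets any positive semidefinite candidate evaluate the definite
  description.\<close>

lemma psd_sqrt_eqI:
  assumes "B \<in> carrier_mat n n" "pos_semidef B" "B * B = M"
  shows "psd_sqrt M = B"
  unfolding psd_sqrt_def
proof (rule the_equality)
  show "B \<in> carrier_mat (dim_row M) (dim_row M) \<and> pos_semidef B \<and> B * B = M" using assms by auto
next
  fix C assume "C \<in> carrier_mat (dim_row M) (dim_row M) \<and> pos_semidef C \<and> C * C = M"
  then show "C = B" using assms psd_square_inj[of C n B] by auto
qed

text \<open>Absolute values are the nonnegative square roots of the eigenvalues
  \<open>d k * d k\<close>.\<close>

lemma (in unitary_mat) psd_sqrt_spectral:
  "psd_sqrt (spectral_mat U d * mat_adjoint (spectral_mat U d)) = spectral_mat U (\<lambda>k. \<bar>d k\<bar>)"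
  by (rule psd_sqrt_eqI[of _ n])
    (auto simp: spectral_adjoint spectral_mult intro: spectral_pos_semidef)

section \<open>The spectral radius of Hermitian matrices\<close>

lemma hermitian_norm_bound:
  assumes A: "A \<in> carrier_mat n n" "mat_adjoint A = A" and n: "n > 0" and x: "x \<in> carrier_vec n"
  shows "(\<Sum>i<n. (cmod ((A *\<^sub>v x) $ i))\<^sup>2) \<le> (spectral_radius A)\<^sup>2 * (\<Sum>i<n. (cmod (x $ i))\<^sup>2)"
proof -
  obtain U d where "unitary_mat U n" and A': "A = spectral_mat U d"
    using hermitian_spectral[OF A] .
  then interpret unitary_mat U n by simp
  let ?z = "\<lambda>k. (cmod ((mat_adjoint U *\<^sub>v x) $ k))\<^sup>2"
  have d: "(d k)\<^sup>2 \<le> (spectral_radius A)\<^sup>2" if "k < n" for k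
  proof -
    have "\<bar>d k\<bar> \<in> norm ` spectrum A"
      using eigenvalue_spectral[OF that, of d] by (force simp: A' spectrum_def)
    then have "\<bar>d k\<bar> \<le> spectral_radius A" using spectral_radius_mem_max(2)[OF A(1) n] by blast
    then show ?thesis using power_mono[of "\<bar>d k\<bar>" _ 2] by simp
  qed
  have Ax: "A *\<^sub>v x \<in> carrier_vec n" using A(1) x by (rule mult_mat_vec_carrier)
  have "complex_of_real (\<Sum>i<n. (cmod ((A *\<^sub>v x) $ i))\<^sup>2) = (A *\<^sub>v x) \<bullet>c (A *\<^sub>v x)"
    by (rule cscalar_prod_self[OF Ax, symmetric])
  also have "\<dots> = ((A * A) *\<^sub>v x) \<bullet>c x"
    using cscalar_prod_adjoint[OF A(1) Ax x] A x by (simp add: assoc_mult_mat_vec[of _ n n _ n])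
  also have "\<dots> = of_real (\<Sum>k<n. (d k)\<^sup>2 * ?z k)"
    unfolding A' spectral_mult spectral_quadratic_form[OF x] by (simp add: power2_eq_square)
  finally have 1: "(\<Sum>i<n. (cmod ((A *\<^sub>v x) $ i))\<^sup>2) = (\<Sum>k<n. (d k)\<^sup>2 * ?z k)"
    by (simp only: of_real_eq_iff)
  \<comment> \<open>The constant function 1 yields the identity matrix, so this is Parseval's
    identity in the eigenbasis.\<close>
  have "complex_of_real (\<Sum>i<n. (cmod (x $ i))\<^sup>2) = (spectral_mat U (\<lambda>_. 1) *\<^sub>v x) \<bullet>c x"
    using cscalar_prod_self[OF x] x by (simp add: spectral_one)
  also have "\<dots> = of_real (\<Sum>k<n. ?z k)"
    unfolding spectral_quadratic_form[OF x] by simp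
  finally have 2: "(\<Sum>i<n. (cmod (x $ i))\<^sup>2) = (\<Sum>k<n. ?z k)"
    by (simp only: of_real_eq_iff)
  show ?thesis unfolding 1 2 sum_distrib_left
    by (intro sum_mono mult_right_mono) (auto simp: d)
qed

lemma spectral_radius_nonneg:
  assumes "A \<in> carrier_mat n n" "n > 0"
  shows "spectral_radius A \<ge> 0"
  using spectral_radius_mem_max(1)[OF assms] by auto

lemma spectral_radius_hermitian_pos:
  assumes A: "A \<in> carrier_mat n n" "mat_adjoint A = A" and n: "n > 0" and "A \<noteq> 0\<^sub>m n n"
  shows "spectral_radius A > 0"
proof (rule ccontr)
  assume "\<not> spectral_radius A > 0"
  then have 0: "spectral_radius A = 0" using spectral_radius_nonneg[OF A(1) n] by simp
  have "e = 0" if "eigenvalue A e" for e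
    using spectral_radius_mem_max(2)[OF A(1) n, of "cmod e"] that by (auto simp: 0 spectrum_def)
  then show False using hermitian_eq_0[OF A] assms(4) by blast
qed

lemma smult_mat_mult_vec:
  fixes A :: "'a :: comm_semiring_0 mat"
  assumes "A \<in> carrier_mat m n" "x \<in> carrier_vec n"
  shows "(c \<cdot>\<^sub>m A) *\<^sub>v x = c \<cdot>\<^sub>v (A *\<^sub>v x)"
  using assms by (intro eq_vecI) (auto simp: scalar_prod_def sum_distrib_left mult.assoc)

text \<open>Some eigenvalue attains the spectral radius in modulus; it is a nonzero real
  \<open>t\<close>, and the cubic identity gives \<open>t^3 = c t\<close>.\<close>

lemma spectral_radius_sq_eqI:
  assumes A: "A \<in> carrier_mat n n" "mat_adjoint A = A" and n: "n > 0" and A0: "A \<noteq> 0\<^sub>m n n"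
    and cube: "A * A * A = of_real c \<cdot>\<^sub>m A"
  shows "(spectral_radius A)\<^sup>2 = c"
proof -
  let ?r = "spectral_radius A"
  have pos: "?r > 0" by (rule spectral_radius_hermitian_pos[OF A n A0])
  obtain e where "eigenvalue A e" and re: "cmod e = ?r"
    using spectral_radius_mem_max(1)[OF A(1) n] by (auto simp: spectrum_def)
  then obtain x where x: "x \<in> carrier_vec n" "x \<noteq> 0\<^sub>v n" and ev: "A *\<^sub>v x = e \<cdot>\<^sub>v x"
    using A by (auto simp: eigenvalue_def eigenvector_def)
  obtain t where t: "e = of_real t"
    using hermitian_eigenvalue_real[OF A ev x] by (auto elim: Reals_cases)
  have t2: "t\<^sup>2 = ?r\<^sup>2" and t0: "t \<noteq> 0" using re pos by (auto simp: t simp flip: re)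
  have "(A * A * A) *\<^sub>v x = (e * (e * e)) \<cdot>\<^sub>v x"
    using A x ev by (simp add: assoc_mult_mat_vec[of _ n n _ n] mult_mat_vec[of _ n n]
        smult_smult_assoc mult.assoc)
  moreover have "(of_real c \<cdot>\<^sub>m A) *\<^sub>v x = (of_real c * e) \<cdot>\<^sub>v x"
    using A x ev by (simp add: smult_mat_mult_vec[of _ n n] smult_smult_assoc)
  ultimately have eq: "(e * (e * e)) \<cdot>\<^sub>v x = (of_real c * e) \<cdot>\<^sub>v x" using cube by simp
  obtain i where i: "i < n" "x $ i \<noteq> 0" using x by (metis carrier_vecD eq_vecI index_zero_vec)
  have "e * (e * e) = of_real c * e"
    using arg_cong[OF eq, of "\<lambda>v. v $ i"] i x by simp
  then have "t * (t * t) = c * t" unfolding t by (metis of_real_eq_iff of_real_mult)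
  then show ?thesis using t0 t2 by (simp add: power2_eq_square)
qed

section \<open>Vertex energies and spectral moments\<close>

lemma hermitian_energy:
  fixes A :: "complex mat"
  assumes A: "A \<in> carrier_mat n n" "mat_adjoint A = A"
    and bound: "\<And>e. eigenvalue A e \<Longrightarrow> cmod e \<le> r"
  shows energy_ge: "\<And>i. i < n \<Longrightarrow>
      Re ((A * A) $$ (i, i)) \<le> r * Re (psd_sqrt (A * mat_adjoint A) $$ (i, i))"
    and energy_eq_imp_cube: "(\<And>i. i < n \<Longrightarrow>
      Re ((A * A) $$ (i, i)) = r * Re (psd_sqrt (A * mat_adjoint A) $$ (i, i))) \<Longrightarrow>
      A * A * A = of_real (r\<^sup>2) \<cdot>\<^sub>m A"
proof -
  obtain U d where "unitary_mat U n" and A': "A = spectral_mat U d"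
    using hermitian_spectral[OF A] .
  then interpret unitary_mat U n by simp
  \<comment> \<open>On the diagonal, \<open>g\<close> yields \<open>r\<close> times the energy minus
    the entry of \<open>A * A\<close>; it is nonnegative because every \<open>|d k|\<close> is at
    most \<open>r\<close>.\<close>
  define g where "g k = \<bar>d k\<bar> * (r - \<bar>d k\<bar>)" for k
  have g: "g k \<ge> 0" if "k < n" for k
    using bound[of "of_real (d k)"] eigenvalue_spectral[OF that, of d] by (simp add: A' g_def)
  have diff: "Re (spectral_mat U g $$ (i, i))
      = r * Re (psd_sqrt (A * mat_adjoint A) $$ (i, i)) - Re ((A * A) $$ (i, i))" if "i < n" for i
    using that unfolding A' psd_sqrt_spectral spectral_mult
    by (simp add: spectral_diag g_def sum_distrib_left algebra_simps sum_subtractf)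
  have "Re (spectral_mat U g $$ (i, i)) \<ge> 0" if "i < n" for i
    using that g by (auto simp: spectral_diag intro!: sum_nonneg)
  then show "Re ((A * A) $$ (i, i)) \<le> r * Re (psd_sqrt (A * mat_adjoint A) $$ (i, i))"
    if "i < n" for i using diff[OF that] that by force
  assume eq: "\<And>i. i < n \<Longrightarrow>
      Re ((A * A) $$ (i, i)) = r * Re (psd_sqrt (A * mat_adjoint A) $$ (i, i))"
  have "g k = 0" if "k < n" for k
    using g _ that by (rule spectral_diag_nonpos_imp_0) (use diff eq in auto)
  \<comment> \<open>A zero of \<open>g\<close> means \<open>d k = 0\<close> or
    \<open>|d k| = r\<close>.\<close>
  then have "d k * d k * d k = r\<^sup>2 * d k" if "k < n" for k
    using that by (fastforce simp: g_def power2_eq_square abs_if split: if_splits)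
  then show "A * A * A = of_real (r\<^sup>2) \<cdot>\<^sub>m A"
    unfolding A' spectral_mult spectral_smult by (rule spectral_cong)
qed

text \<open>The function \<open>d^2 (r^2 - d^2)\<close> is nonnegative on the spectrum, while
  \<open>le\<close> makes its diagonal entries at most 0; hence it vanishes at every
  eigenvalue.\<close>

lemma hermitian_fourth_moment:
  fixes A :: "complex mat"
  assumes A: "A \<in> carrier_mat n n" "mat_adjoint A = A"
    and bound: "\<And>e. eigenvalue A e \<Longrightarrow> cmod e \<le> r"
    and le: "\<And>i. i < n \<Longrightarrow> r\<^sup>2 * Re ((A * A) $$ (i, i)) \<le> Re ((A * A * A * A) $$ (i, i))"
  shows "A * A * A = of_real (r\<^sup>2) \<cdot>\<^sub>m A"
proof -
  obtain U d where "unitary_mat U n" and A': "A = spectral_mat U d"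
    using hermitian_spectral[OF A] .
  then interpret unitary_mat U n by simp
  define g where "g k = (d k)\<^sup>2 * (r\<^sup>2 - (d k)\<^sup>2)" for k
  have g: "g k \<ge> 0" if "k < n" for k
  proof -
    have "\<bar>d k\<bar> \<le> r"
      using bound[of "of_real (d k)"] eigenvalue_spectral[OF that, of d] by (simp add: A')
    then have "(d k)\<^sup>2 \<le> r\<^sup>2" using power_mono[of "\<bar>d k\<bar>" r 2] by simp
    then show ?thesis by (simp add: g_def)
  qed
  have diff: "Re (spectral_mat U g $$ (i, i))
      = r\<^sup>2 * Re ((A * A) $$ (i, i)) - Re ((A * A * A * A) $$ (i, i))" if "i < n" for i
    using that unfolding A' spectral_mult
    by (simp add: spectral_diag g_def sum_distrib_left algebra_simps sum_subtractf power2_eq_square)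
  have "g k = 0" if "k < n" for k
    using g _ that by (rule spectral_diag_nonpos_imp_0) (use diff le in auto)
  then have "d k * d k * d k = r\<^sup>2 * d k" if "k < n" for k
    using that by (fastforce simp: g_def power2_eq_square)
  then show "A * A * A = of_real (r\<^sup>2) \<cdot>\<^sub>m A"
    unfolding A' spectral_mult spectral_smult by (rule spectral_cong)
qed

text \<open>\<open>A^2 / r\<close> has eigenvalues \<open>d^2 / r \<ge> 0\<close>, and its square
  \<open>A^4 / r^2\<close> collapses to \<open>A^2\<close> by the cubic identity.\<close>

lemma cube_imp_psd_sqrt:
  fixes A :: "complex mat"
  assumes A: "A \<in> carrier_mat n n" "mat_adjoint A = A" and r: "r > 0"
    and cube: "A * A * A = of_real (r\<^sup>2) \<cdot>\<^sub>m A"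
  shows "psd_sqrt (A * mat_adjoint A) = of_real (1 / r) \<cdot>\<^sub>m (A * A)"
proof (rule psd_sqrt_eqI)
  show "of_real (1 / r) \<cdot>\<^sub>m (A * A) \<in> carrier_mat n n" using A by auto
  obtain U d where "unitary_mat U n" and A': "A = spectral_mat U d"
    using hermitian_spectral[OF A] .
  then interpret unitary_mat U n by simp
  show "pos_semidef (of_real (1 / r) \<cdot>\<^sub>m (A * A))"
    unfolding A' spectral_mult spectral_smult using r by (intro spectral_pos_semidef) simp
  have AA: "A * A \<in> carrier_mat n n" using A by auto
  have "of_real (1 / r) \<cdot>\<^sub>m (A * A) * (of_real (1 / r) \<cdot>\<^sub>m (A * A))
      = (of_real (1 / r) * of_real (1 / r)) \<cdot>\<^sub>m (A * A * A * A)"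
    unfolding A' spectral_mult spectral_smult of_real_mult[symmetric]
    by (rule spectral_cong) simp
  also have "A * A * A * A = of_real (r\<^sup>2) \<cdot>\<^sub>m (A * A)"
    unfolding cube using A(1) A(1) by (rule mult_smult_assoc_mat)
  also have "(of_real (1 / r) * of_real (1 / r)) \<cdot>\<^sub>m (of_real (r\<^sup>2) \<cdot>\<^sub>m (A * A)) = A * A"
    using r A by (intro eq_matI) (auto simp: power2_eq_square)
  finally show "of_real (1 / r) \<cdot>\<^sub>m (A * A) * (of_real (1 / r) \<cdot>\<^sub>m (A * A)) = A * mat_adjoint A"
    using A by simp
qed

text \<open>Equality case of the triangle inequality: the nonnegative differences
  \<open>cmod (f x) - Re (f x)\<close> add up to 0, so each one vanishes.\<close>

lemma sum_eq_sum_norm_imp: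
  fixes f :: "'b \<Rightarrow> complex"
  assumes "finite S" "(\<Sum>x\<in>S. f x) = of_real (\<Sum>x\<in>S. cmod (f x))" "x \<in> S"
  shows "f x = of_real (cmod (f x))"
proof -
  have "(\<Sum>x\<in>S. cmod (f x) - Re (f x)) = 0"
    using arg_cong[OF assms(2), of Re] by (simp add: sum_subtractf)
  then have "cmod (f x) = Re (f x)"
    using assms(1,3) complex_Re_le_cmod by (subst (asm) sum_nonneg_eq_0_iff) auto
  then show ?thesis
    using cmod_power2[of "f x"] by (simp add: complex_eq_iff)
qed

lemma of_real_of_bool: "of_real (of_bool P) = of_bool P"
  by simp

section \<open>Gain graphs\<close>

locale enum_gain_graph = gain_graph G \<phi> for G :: "'a pair_pre_digraph" and \<phi> +
  fixes vs :: "'a list"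
  assumes distinct_vs: "distinct vs" and set_vs: "set vs = pverts G"
begin

abbreviation "n \<equiv> length vs"
abbreviation "V \<equiv> pverts G"
abbreviation "E \<equiv> parcs G"
abbreviation "A \<equiv> gain_adj_mat G \<phi> vs"

text \<open>Extending the gain by 0 lets sums over walks range over all tuples of vertices.\<close>

definition wt :: "'a \<Rightarrow> 'a \<Rightarrow> complex" where
  "wt p q = (if (p, q) \<in> E then \<phi> (p, q) else 0)"

lemma vs_in: "i < n \<Longrightarrow> vs ! i \<in> V"
  using set_vs nth_mem by blast

lemma ex_index: "p \<in> V \<Longrightarrow> \<exists>i<n. vs ! i = p"
  by (metis in_set_conv_nth set_vs)

lemma sum_vs: "(\<Sum>i<n. f (vs ! i)) = (\<Sum>p\<in>V. f p)"
proof -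
  have "bij_betw ((!) vs) {..<n} V" by (rule bij_betw_nth) (simp_all add: distinct_vs set_vs)
  then show ?thesis by (rule sum.reindex_bij_betw)
qed

lemma gain_neq_0: "e \<in> E \<Longrightarrow> \<phi> e \<noteq> 0"
  using gain_unit[of e] by auto

lemma gain_reverse: "(p, q) \<in> E \<Longrightarrow> \<phi> (p, q) * \<phi> (q, p) = 1"
  using gain_inverse[of p q] gain_neq_0[of "(q, p)"] arcs_symmetric[of p q] by simp

lemma norm_wt: "cmod (wt p q) = of_bool ((p, q) \<in> E)"
  by (simp add: wt_def gain_unit)

lemma wt_eq_0_iff: "wt p q = 0 \<longleftrightarrow> (p, q) \<notin> E"
  by (simp add: wt_def gain_neq_0)

lemma cnj_wt: "cnj (wt p q) = wt q p"
proof (cases "(p, q) \<in> E")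
  case True
  then have E: "(q, p) \<in> E" by (rule arcs_symmetric)
  have "\<phi> (q, p) = inverse (\<phi> (p, q))" using gain_inverse[OF E] .
  also have "\<dots> = cnj (\<phi> (p, q))"
    using gain_unit[OF True] complex_norm_square[of "\<phi> (p, q)"] by (intro inverse_unique) simp
  finally show ?thesis using True E by (simp add: wt_def)
next
  case False
  then have "(q, p) \<notin> E" using arcs_symmetric by blast
  then show ?thesis using False by (simp add: wt_def)
qed

lemma wt_mult_cnj: "wt p q * wt q p = of_bool ((p, q) \<in> E)"
  using complex_norm_square[of "wt p q", symmetric]
  by (cases "(p, q) \<in> E") (simp_all add: cnj_wt norm_wt wt_eq_0_iff)

lemma A_carrier [simp, intro]: "A \<in> carrier_mat n n"
  by (simp add: gain_adj_mat_def)

lemma A_dim [simp]: "dim_row A = n" "dim_col A = n"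
  by (simp_all add: gain_adj_mat_def)

lemma A_index: "i < n \<Longrightarrow> j < n \<Longrightarrow> A $$ (i, j) = wt (vs ! i) (vs ! j)"
  by (simp add: gain_adj_mat_def wt_def)

lemma A_hermitian: "mat_adjoint A = A"
  by (rule eq_matI) (auto simp: A_index cnj_wt)

lemma A2_index:
  assumes "i < n" "j < n"
  shows "(A * A) $$ (i, j) = (\<Sum>q\<in>V. wt (vs ! i) q * wt q (vs ! j))"
proof -
  have "(A * A) $$ (i, j) = (\<Sum>k<n. A $$ (i, k) * A $$ (k, j))"
    using assms by (intro index_mult_mat_sum) auto
  also have "\<dots> = (\<Sum>k<n. (\<lambda>q. wt (vs ! i) q * wt q (vs ! j)) (vs ! k))"
    using assms by (simp add: A_index)
  also have "\<dots> = (\<Sum>q\<in>V. wt (vs ! i) q * wt q (vs ! j))" by (rule sum_vs)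
  finally show ?thesis .
qed

text \<open>A closed walk of length 2 runs along an arc and back, hence has gain 1 and counts one
  neighbour.\<close>

lemma A2_diag:
  assumes "i < n"
  shows "(A * A) $$ (i, i) = of_nat (vertex_degree G (vs ! i))"
proof -
  let ?p = "vs ! i"
  have "out_arcs G ?p = Pair ?p ` {q \<in> V. (?p, q) \<in> E}"
    using in_arcsD2 by (auto simp: out_arcs_def)
  then have "vertex_degree G ?p = card {q \<in> V. (?p, q) \<in> E}"
    by (simp add: vertex_degree_def out_degree_def card_image inj_on_def)
  also have "of_nat \<dots> = (\<Sum>q\<in>V. of_bool ((?p, q) \<in> E) :: complex)"
    by (simp add: sum_of_bool_eq pair_finite_verts Int_def)
  finally show ?thesis using assms by (simp add: A2_index wt_mult_cnj del: index_mult_mat(1))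
qed

lemma A3_index:
  assumes "i < n" "j < n"
  shows "(A * A * A) $$ (i, j) = (\<Sum>(q, r)\<in>V \<times> V. wt (vs ! i) q * wt q r * wt r (vs ! j))"
proof -
  have "(A * A * A) $$ (i, j) = (\<Sum>k<n. (A * A) $$ (i, k) * A $$ (k, j))"
    using assms by (intro index_mult_mat_sum mult_carrier_mat[of _ n n]) auto
  also have "\<dots> = (\<Sum>k<n. (\<lambda>r. (\<Sum>q\<in>V. wt (vs ! i) q * wt q r) * wt r (vs ! j)) (vs ! k))"
    using assms by (intro sum.cong refl) (simp only: lessThan_iff A2_index A_index)
  also have "\<dots> = (\<Sum>r\<in>V. (\<Sum>q\<in>V. wt (vs ! i) q * wt q r) * wt r (vs ! j))" by (rule sum_vs)
  also have "\<dots> = (\<Sum>r\<in>V. \<Sum>q\<in>V. wt (vs ! i) q * wt q r * wt r (vs ! j))"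
    by (simp only: sum_distrib_right)
  also have "\<dots> = (\<Sum>q\<in>V. \<Sum>r\<in>V. wt (vs ! i) q * wt q r * wt r (vs ! j))"
    by (rule sum.swap)
  finally show ?thesis by (simp add: sum.cartesian_product)
qed

lemma A3_eqI:
  assumes "\<And>p s. p \<in> V \<Longrightarrow> s \<in> V \<Longrightarrow>
    (\<Sum>(q, r)\<in>V \<times> V. wt p q * wt q r * wt r s) = c * wt p s"
  shows "A * A * A = c \<cdot>\<^sub>m A"
proof (rule eq_matI)
  fix i j assume "i < dim_row (c \<cdot>\<^sub>m A)" "j < dim_col (c \<cdot>\<^sub>m A)"
  then have ij: "i < n" "j < n" by auto
  then show "(A * A * A) $$ (i, j) = (c \<cdot>\<^sub>m A) $$ (i, j)"
    using assms[OF vs_in vs_in] by (simp add: A3_index A_index del: index_mult_mat(1))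
qed auto

lemma A3_eqD:
  assumes "A * A * A = c \<cdot>\<^sub>m A" "p \<in> V" "s \<in> V"
  shows "(\<Sum>(q, r)\<in>V \<times> V. wt p q * wt q r * wt r s) = c * wt p s"
proof -
  obtain i j where ij: "i < n" "j < n" "vs ! i = p" "vs ! j = s" using assms ex_index by metis
  have "(A * A * A) $$ (i, j) = (c \<cdot>\<^sub>m A) $$ (i, j)" by (simp add: assms(1))
  then show ?thesis using ij by (simp add: A3_index A_index del: index_mult_mat(1))
qed

lemma A_nonzero:
  assumes "E \<noteq> {}"
  shows "A \<noteq> 0\<^sub>m n n" "n > 0"
proof -
  obtain p q where pq: "(p, q) \<in> E" using assms by auto
  then obtain i j where "i < n" "j < n" "vs ! i = p" "vs ! j = q"
    using ex_index in_arcsD1 in_arcsD2 by metis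
  then have "n > 0" "A $$ (i, j) \<noteq> 0" "i < n" "j < n" using pq by (auto simp: A_index wt_eq_0_iff)
  then show "A \<noteq> 0\<^sub>m n n" "n > 0" by auto
qed

text \<open>The 0/1 adjacency matrix is the gain matrix for the constant gain 1, so all facts about
  gain matrices apply to it as well.\<close>

lemma unit_gain: "enum_gain_graph G (\<lambda>_. 1) vs"
  by unfold_locales (auto simp: distinct_vs set_vs)

lemma unit_gain_adj_mat: "gain_adj_mat G (\<lambda>_. 1) vs = adj_mat G vs"
  by (simp add: gain_adj_mat_def adj_mat_def)

end

section \<open>Comparison of the gain matrix with the 0/1 adjacency matrix\<close>

context enum_gain_graph
begin

interpretation B: enum_gain_graph G "\<lambda>_. 1" vs
  rewrites "gain_adj_mat G (\<lambda>_. 1) vs = adj_mat G vs"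
  by (rule unit_gain) (rule unit_gain_adj_mat)

abbreviation "B \<equiv> adj_mat G vs"
abbreviation "\<rho> \<equiv> graph_spectral_radius G vs"

lemma B_wt: "B.wt p q = of_bool ((p, q) \<in> E)"
  by (simp add: B.wt_def)

lemma rho_pos: "E \<noteq> {} \<Longrightarrow> \<rho> > 0"
  unfolding graph_spectral_radius_def
  by (intro spectral_radius_hermitian_pos[of _ n] B.A_carrier B.A_hermitian B.A_nonzero)

text \<open>For an eigenvector \<open>x\<close> of the gain matrix, \<open>y = |x|\<close> satisfies \<open>|e| y \<le> B y\<close> entrywise.\<close>

lemma eigenvalue_le_rho:
  assumes "E \<noteq> {}" "eigenvalue A e"
  shows "cmod e \<le> \<rho>"
proof -
  obtain x where x: "x \<in> carrier_vec n" "x \<noteq> 0\<^sub>v n" and ev: "A *\<^sub>v x = e \<cdot>\<^sub>v x"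
    using assms by (auto simp: eigenvalue_def eigenvector_def)
  define y where "y = vec n (\<lambda>i. complex_of_real (cmod (x $ i)))"
  have y: "y \<in> carrier_vec n" by (simp add: y_def)
  let ?s = "\<Sum>i<n. (cmod (x $ i))\<^sup>2"
  have le: "cmod e * cmod (x $ i) \<le> cmod ((B *\<^sub>v y) $ i)" if i: "i < n" for i
  proof -
    have "e * x $ i = (A *\<^sub>v x) $ i" using ev x i by simp
    also have "\<dots> = (\<Sum>k<n. A $$ (i, k) * x $ k)"
      using x i by (intro index_mult_mat_vec_sum) auto
    finally have "cmod (e * x $ i) \<le> (\<Sum>k<n. cmod (A $$ (i, k) * x $ k))"
      by (simp only: norm_sum)
    also have "\<dots> = Re (\<Sum>k<n. B $$ (i, k) * y $ k)"
      unfolding Re_sum using i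
      by (intro sum.cong refl) (simp add: A_index B.A_index norm_mult norm_wt B_wt y_def)
    also have "\<dots> = Re ((B *\<^sub>v y) $ i)"
      using index_mult_mat_vec_sum[OF B.A_carrier y i] by simp
    also have "\<dots> \<le> cmod ((B *\<^sub>v y) $ i)" by (rule complex_Re_le_cmod)
    finally show ?thesis by (simp add: norm_mult)
  qed
  \<comment> \<open>By \<open>le\<close>, \<open>B\<close> stretches \<open>y\<close> by at least
    \<open>cmod e\<close>; being Hermitian, it stretches no vector by more than
    \<open>\<rho>\<close>, and \<open>y\<close> is as long as \<open>x\<close>.\<close>
  have "(cmod e)\<^sup>2 * ?s = (\<Sum>i<n. (cmod e * cmod (x $ i))\<^sup>2)"
    by (simp add: sum_distrib_left power_mult_distrib)
  also have "\<dots> \<le> (\<Sum>i<n. (cmod ((B *\<^sub>v y) $ i))\<^sup>2)"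
    by (intro sum_mono power_mono) (use le in auto)
  also have "\<dots> \<le> \<rho>\<^sup>2 * (\<Sum>i<n. (cmod (y $ i))\<^sup>2)"
    unfolding graph_spectral_radius_def
    by (rule hermitian_norm_bound[OF B.A_carrier B.A_hermitian A_nonzero(2)[OF assms(1)] y])
  also have "(\<Sum>i<n. (cmod (y $ i))\<^sup>2) = ?s" by (simp add: y_def)
  finally have "(cmod e)\<^sup>2 * ?s \<le> \<rho>\<^sup>2 * ?s" .
  moreover have "?s > 0"
  proof -
    obtain i where "i < n" "x $ i \<noteq> 0" using x by (metis carrier_vecD eq_vecI index_zero_vec)
    then show ?thesis by (intro sum_pos2[of _ i]) auto
  qed
  ultimately have "(cmod e)\<^sup>2 \<le> \<rho>\<^sup>2" by simp
  then show ?thesis using rho_pos[OF assms(1)] by (auto intro: power2_le_imp_le)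
qed

lemma unit_eigenvalue_le_rho: "E \<noteq> {} \<Longrightarrow> eigenvalue B e \<Longrightarrow> cmod e \<le> \<rho>"
  unfolding graph_spectral_radius_def
  by (rule spectral_radius_mem_max(2)[OF B.A_carrier A_nonzero(2)]) (auto simp: spectrum_def)

text \<open>The entries of \<open>B^3\<close>, kept real so that they can be compared with
  \<open>\<rho>^2\<close>.\<close>

abbreviation walks3 :: "'a \<Rightarrow> 'a \<Rightarrow> real" where
  "walks3 p s \<equiv> \<Sum>(q, r)\<in>V \<times> V. of_bool ((p, q) \<in> E \<and> (q, r) \<in> E \<and> (r, s) \<in> E)"

lemma B3_sum:
  "(\<Sum>(q, r)\<in>V \<times> V. B.wt p q * B.wt q r * B.wt r s) = of_real (walks3 p s)"
  unfolding of_real_sum by (intro sum.cong refl) (auto simp: B_wt)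

lemma norm_wt3: "cmod (wt p q * wt q r * wt r s) = of_bool ((p, q) \<in> E \<and> (q, r) \<in> E \<and> (r, s) \<in> E)"
  by (simp add: norm_mult norm_wt)

text \<open>
  The triangle inequality in \<open>A\<^sup>3 = \<rho>\<^sup>2 A\<close> gives \<open>B\<^sup>3 \<ge> \<rho>\<^sup>2 B\<close> entrywise. The diagonal of \<open>B\<^sup>4\<close> then
  dominates that of \<open>\<rho>\<^sup>2 B\<^sup>2\<close>, which the spectral bound \<open>\<rho>\<close> permits only if \<open>B\<^sup>3 = \<rho>\<^sup>2 B\<close>.
\<close>

lemma walks3_if_cube:
  assumes ne: "E \<noteq> {}" and cube: "A * A * A = of_real (\<rho>\<^sup>2) \<cdot>\<^sub>m A" and ps: "p \<in> V" "s \<in> V"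
  shows "walks3 p s = \<rho>\<^sup>2 * of_bool ((p, s) \<in> E)"
proof -
  have ge: "walks3 p s \<ge> \<rho>\<^sup>2 * of_bool ((p, s) \<in> E)" if ps: "p \<in> V" "s \<in> V" for p s
  proof -
    have "\<rho>\<^sup>2 * of_bool ((p, s) \<in> E) = cmod (of_real (\<rho>\<^sup>2) * wt p s)"
      by (simp add: norm_mult norm_wt norm_power)
    also have "\<dots> = cmod (\<Sum>(q, r)\<in>V \<times> V. wt p q * wt q r * wt r s)"
      using A3_eqD[OF cube ps] by simp
    also have "\<dots> \<le> (\<Sum>x\<in>V \<times> V. cmod (case x of (q, r) \<Rightarrow> wt p q * wt q r * wt r s))"
      by (rule norm_sum)
    also have "\<dots> = walks3 p s" by (intro sum.cong refl) (auto simp only: split norm_wt3)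
    finally show ?thesis .
  qed
  have "B * B * B = of_real (\<rho>\<^sup>2) \<cdot>\<^sub>m B"
  proof (rule hermitian_fourth_moment[OF B.A_carrier B.A_hermitian unit_eigenvalue_le_rho[OF ne]])
    fix i assume i: "i < n"
    let ?p = "vs ! i"
    have B3: "(B * B * B) $$ (i, k) = of_real (walks3 ?p (vs ! k))" if "k < n" for k
      unfolding B.A3_index[OF i that] B3_sum ..
    have "(B * B * B * B) $$ (i, i) = (\<Sum>k<n. (B * B * B) $$ (i, k) * B $$ (k, i))"
      using i by (intro index_mult_mat_sum mult_carrier_mat[of _ n n]) auto
    also have "\<dots> = (\<Sum>k<n. (\<lambda>s. of_real (walks3 ?p s) * of_bool ((s, ?p) \<in> E)) (vs ! k))"
      using i by (intro sum.cong refl) (simp only: lessThan_iff B3 B.A_index B_wt)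
    also have "\<dots> = (\<Sum>s\<in>V. of_real (walks3 ?p s) * of_bool ((s, ?p) \<in> E))" by (rule sum_vs)
    also have "\<dots> = of_real (\<Sum>s\<in>V. walks3 ?p s * of_bool ((s, ?p) \<in> E))"
      by (simp only: of_real_sum of_real_mult of_real_of_bool)
    finally have 4: "Re ((B * B * B * B) $$ (i, i)) = (\<Sum>s\<in>V. walks3 ?p s * of_bool ((s, ?p) \<in> E))"
      by (simp only: Re_complex_of_real)
    have "(B * B) $$ (i, i) = of_real (\<Sum>s\<in>V. of_bool ((?p, s) \<in> E) * of_bool ((s, ?p) \<in> E))"
      unfolding B.A2_index[OF i i] of_real_sum by (intro sum.cong refl) (simp add: B_wt)
    then have "\<rho>\<^sup>2 * Re ((B * B) $$ (i, i))
        = (\<Sum>s\<in>V. \<rho>\<^sup>2 * of_bool ((?p, s) \<in> E) * of_bool ((s, ?p) \<in> E))"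
      by (simp only: Re_complex_of_real sum_distrib_left mult.assoc)
    also have "\<dots> \<le> Re ((B * B * B * B) $$ (i, i))"
      unfolding 4 by (intro sum_mono mult_right_mono ge vs_in i) auto
    finally show "\<rho>\<^sup>2 * Re ((B * B) $$ (i, i)) \<le> Re ((B * B * B * B) $$ (i, i))" .
  qed
  from B.A3_eqD[OF this ps, unfolded B3_sum]
  have "complex_of_real (walks3 p s) = of_real (\<rho>\<^sup>2 * of_bool ((p, s) \<in> E))"
    by (simp only: B_wt of_real_mult of_real_of_bool)
  then show ?thesis by (simp only: of_real_eq_iff)
qed

text \<open>
  For an arc \<open>(p, s)\<close> the gains of the \<open>\<rho>\<^sup>2\<close> walks of length 3 from \<open>p\<close> to \<open>s\<close> add up to
  \<open>\<rho>\<^sup>2 \<phi> (p, s)\<close>; being of modulus 1, they all coincide with \<open>\<phi> (p, s)\<close>.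
\<close>

lemma walk3_if_cube:
  assumes ne: "E \<noteq> {}" and cube: "A * A * A = of_real (\<rho>\<^sup>2) \<cdot>\<^sub>m A"
    and walk: "(p, q) \<in> E" "(q, r) \<in> E" "(r, s) \<in> E"
  shows "(p, s) \<in> E" "\<phi> (p, q) * \<phi> (q, r) * \<phi> (r, s) = \<phi> (p, s)"
proof -
  have V: "p \<in> V" "q \<in> V" "r \<in> V" "s \<in> V" using walk in_arcsD1 in_arcsD2 by auto
  have fin: "finite (V \<times> V)" by (simp add: pair_finite_verts)
  \<comment> \<open>The given walk is counted, whereas without an arc from \<open>p\<close> to
    \<open>s\<close> the count would be \<open>\<rho>^2 * 0\<close>.\<close>
  have "walks3 p s > 0"
    using walk V fin by (intro sum_pos2[of _ "(q, r)"]) auto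
  then show ps: "(p, s) \<in> E" using walks3_if_cube[OF ne cube V(1,4)]
    by (cases "(p, s) \<in> E") auto
  \<comment> \<open>The factor \<open>wt s p\<close> closes each walk, so that agreement with
    \<open>\<phi> (p, s)\<close> becomes the value 1 and the equality case of the triangle
    inequality applies.\<close>
  define f where "f = (\<lambda>(q, r). wt p q * wt q r * wt r s * wt s p)"
  have cf: "cmod (f x) = (case x of (q, r) \<Rightarrow> of_bool ((p, q) \<in> E \<and> (q, r) \<in> E \<and> (r, s) \<in> E))" for x
    using arcs_symmetric[OF ps] by (auto simp: f_def norm_mult norm_wt split: prod.split)
  have "(\<Sum>x\<in>V \<times> V. f x) = (\<Sum>(q, r)\<in>V \<times> V. wt p q * wt q r * wt r s) * wt s p"
    unfolding sum_distrib_right by (intro sum.cong refl) (auto simp: f_def)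
  also have "\<dots> = of_real (\<rho>\<^sup>2) * (wt p s * wt s p)"
    using A3_eqD[OF cube V(1,4)] by simp
  also have "\<dots> = of_real (walks3 p s)"
    unfolding walks3_if_cube[OF ne cube V(1,4)] using ps by (simp add: wt_mult_cnj)
  also have "walks3 p s = (\<Sum>x\<in>V \<times> V. cmod (f x))" unfolding cf ..
  finally have "f (q, r) = of_real (cmod (f (q, r)))"
    using fin V by (intro sum_eq_sum_norm_imp) auto
  then have "wt p q * wt q r * wt r s * wt s p = 1"
    using walk unfolding cf by (simp add: f_def)
  then have "\<phi> (p, q) * \<phi> (q, r) * \<phi> (r, s) * \<phi> (s, p) = 1"
    using walk arcs_symmetric[OF ps] by (simp add: wt_def)
  then show "\<phi> (p, q) * \<phi> (q, r) * \<phi> (r, s) = \<phi> (p, s)"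
    using gain_reverse[OF ps] by (metis mult.assoc mult.commute mult.right_neutral)
qed

end

section \<open>From walks of length 3 to balance and bipartiteness\<close>

lemma (in gain_graph) odd_walk_arc:
  assumes walk3: "\<And>p q r s. (p, q) \<in> parcs G \<Longrightarrow> (q, r) \<in> parcs G \<Longrightarrow> (r, s) \<in> parcs G \<Longrightarrow>
      (p, s) \<in> parcs G \<and> \<phi> (p, q) * \<phi> (q, r) * \<phi> (r, s) = \<phi> (p, s)"
  shows "awalk u c v \<Longrightarrow> odd (length c) \<Longrightarrow> (u, v) \<in> parcs G \<and> cycle_gain \<phi> c = \<phi> (u, v)"
proof (induction c arbitrary: u rule: induct_list012)
  case (2 e)
  then show ?case by (cases e) (auto simp: awalk_simps cycle_gain_def)
next
  \<comment> \<open>Beyond its first two arcs the walk is again odd and contracts to one arc by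
    induction; \<open>walk3\<close> contracts the resulting three arcs.\<close>
  case (3 e f c)
  obtain x y where e: "e = (u, x)" and f: "f = (x, y)"
    using 3(3) by (cases e, cases f) (auto simp: awalk_Cons_iff)
  have arcs: "(u, x) \<in> parcs G" "(x, y) \<in> parcs G" and walk: "awalk y c v"
    using 3(3) by (auto simp: awalk_Cons_iff e f)
  have IH: "(y, v) \<in> parcs G" "cycle_gain \<phi> c = \<phi> (y, v)"
    using 3(1)[OF walk] 3(4) by auto
  show ?case using walk3[OF arcs IH(1)] IH(2) by (simp add: cycle_gain_def e f mult.assoc)
qed simp

context enum_gain_graph
begin

text \<open>The two sides consist of the vertices reached from \<open>u0\<close> by walks of even
  and of odd length. Odd walks contract to arcs, which makes the sides completely joined and, for
  want of loops, disjoint.\<close>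

lemma complete_bipartite_if_walk3:
  assumes conn: "Digraph_Component.connected (with_proj G)" and ne: "E \<noteq> {}"
    and walk3: "\<And>p q r s. (p, q) \<in> E \<Longrightarrow> (q, r) \<in> E \<Longrightarrow> (r, s) \<in> E \<Longrightarrow>
      (p, s) \<in> E \<and> \<phi> (p, q) * \<phi> (q, r) * \<phi> (r, s) = \<phi> (p, s)"
  shows "complete_bipartite_graph G"
proof -
  obtain u0 v0 where uv: "(u0, v0) \<in> E" using ne by auto
  define X where "X = {v. \<exists>c. awalk u0 c v \<and> even (length c)}"
  define Y where "Y = {v. \<exists>c. awalk u0 c v \<and> odd (length c)}"
  have len_rev: "length (rev_path c) = length c" for c :: "('a \<times> 'a) list" by (induction c) auto
  have XY: "(x, y) \<in> E" if xy: "x \<in> X" "y \<in> Y" for x y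
  proof -
    obtain c d where "awalk u0 c x" "even (length c)" "awalk u0 d y" "odd (length d)"
      using xy unfolding X_def Y_def by blast
    \<comment> \<open>Running back from \<open>x\<close> to \<open>u0\<close> and on to
      \<open>y\<close> takes an even plus an odd number of arcs.\<close>
    then have "awalk x (rev_path c @ d) y" "odd (length (rev_path c @ d))"
      by (auto intro!: awalk_appendI[of x _ u0] simp: len_rev simp del: awalk_append_iff)
    then show ?thesis using odd_walk_arc[OF walk3] by blast
  qed
  have step: "awalk u0 (c @ [(x, y)]) y" if "awalk u0 c x" "(x, y) \<in> E" for c x y
    using that in_arcsD2[OF that(2)]
    by (intro awalk_appendI[of u0 c x]) (auto simp: awalk_simps)
  have XE: "y \<in> Y" if "x \<in> X" and xy: "(x, y) \<in> E" for x y
  proof -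
    obtain c where "awalk u0 c x" "even (length c)" using \<open>x \<in> X\<close> unfolding X_def by blast
    then show ?thesis using step[OF _ xy, of c] unfolding Y_def
      by (intro CollectI exI[of _ "c @ [(x, y)]"]) simp
  qed
  have YE: "y \<in> X" if "x \<in> Y" and xy: "(x, y) \<in> E" for x y
  proof -
    obtain c where "awalk u0 c x" "odd (length c)" using \<open>x \<in> Y\<close> unfolding Y_def by blast
    then show ?thesis using step[OF _ xy, of c] unfolding X_def
      by (intro CollectI exI[of _ "c @ [(x, y)]"]) simp
  qed
  have sub: "X \<subseteq> V" "Y \<subseteq> V" unfolding X_def Y_def using awalk_last_in_verts by blast+
  have "strongly_connected (with_proj G)"
    using symmetric_connected_imp_strongly_connected[OF sym_arcs conn] .
  then have reach: "\<exists>c. awalk u0 c v" if "v \<in> V" for v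
    using that in_arcsD1[OF uv] unfolding strongly_connected_def
    by (metis reachable_awalk with_proj_simps(1))
  have V: "V = X \<union> Y"
  proof (intro equalityI subsetI)
    fix v assume "v \<in> V"
    then obtain c where "awalk u0 c v" using reach by blast
    then show "v \<in> X \<union> Y" unfolding X_def Y_def by (cases "even (length c)") blast+
  qed (use sub in blast)
  \<comment> \<open>A vertex on both sides would be joined to itself by \<open>XY\<close>.\<close>
  have disj: "X \<inter> Y = {}" using XY no_loops' by blast
  have E: "E = X \<times> Y \<union> Y \<times> X"
  proof (intro equalityI subrelI)
    fix x y assume xy: "(x, y) \<in> E"
    then have "x \<in> X \<union> Y" using V in_arcsD1 by blast
    then show "(x, y) \<in> X \<times> Y \<union> Y \<times> X" using xy XE YE by auto
  qed (use XY arcs_symmetric in blast)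
  have fin: "finite X" "finite Y" using sub pair_finite_verts finite_subset by blast+
  have "u0 \<in> X" using in_arcsD1[OF uv]
    unfolding X_def by (intro CollectI exI[of _ "[]"]) (simp add: awalk_Nil_iff)
  then have "v0 \<in> Y" using XE uv by blast
  then have "0 < card X" "0 < card Y" using fin \<open>u0 \<in> X\<close> by (auto simp: card_gt_0_iff)
  moreover have "complete_bipartite_digraph (card X) (card Y) (with_proj G)"
    unfolding complete_bipartite_digraph_pair_def using V disj E pair_finite_verts by blast
  ultimately show ?thesis unfolding complete_bipartite_graph_def by blast
qed

text \<open>An odd cycle would contract to a loop. An even one, stripped of its first arc
  \<open>(u, x)\<close>, contracts to the reverse arc \<open>(x, u)\<close>, and the two gains
  cancel.\<close>

lemma balanced_if_walk3:
  assumes walk3: "\<And>p q r s. (p, q) \<in> E \<Longrightarrow> (q, r) \<in> E \<Longrightarrow> (r, s) \<in> E \<Longrightarrow>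
      (p, s) \<in> E \<and> \<phi> (p, q) * \<phi> (q, r) * \<phi> (r, s) = \<phi> (p, s)"
  shows "balanced G \<phi>"
  unfolding balanced_def
proof (intro allI impI)
  fix c assume "graph_cycle G c"
  then obtain u where u: "awalk u c u" and "c \<noteq> []"
    by (auto simp: graph_cycle_def cycle_def)
  then obtain x c' where c: "c = (u, x) # c'" and ux: "(u, x) \<in> E" and walk: "awalk x c' u"
    by (cases c) (auto simp: awalk_Cons_iff)
  have "even (length c)" using odd_walk_arc[OF walk3 u] no_loops' by blast
  then have "cycle_gain \<phi> c' = \<phi> (x, u)" using odd_walk_arc[OF walk3 walk] by (simp add: c)
  then show "cycle_gain \<phi> c = 1" using gain_reverse[OF ux] by (simp add: c cycle_gain_def)
qed

section \<open>Balanced complete bipartite graphs\<close>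

lemma walk3_gain_if_balanced:
  assumes bal: "balanced G \<phi>" and walk: "(p, q) \<in> E" "(q, r) \<in> E" "(r, s) \<in> E" "(p, s) \<in> E"
  shows "\<phi> (p, q) * \<phi> (q, r) * \<phi> (r, s) = \<phi> (p, s)"
\<comment> \<open>In these cases the walk runs along some arc and back, which contributes gain
  1.\<close>
proof (cases "q = s \<or> p = r")
  case True
  then show ?thesis
  proof
    assume "q = s"
    then show ?thesis using gain_reverse[OF walk(2)] by (simp add: mult.assoc)
  next
    assume "p = r"
    then show ?thesis using gain_reverse[OF walk(1)] by simp
  qed
next
  case False
  have sp: "(s, p) \<in> E" using walk(4) by (rule arcs_symmetric)
  \<comment> \<open>Adjacent vertices differ for want of loops, so closing the walk by
    \<open>(s, p)\<close> now gives a genuine cycle of length 4.\<close>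
  let ?c = "[(p, q), (q, r), (r, s), (s, p)]"
  have "graph_cycle G ?c"
    unfolding graph_cycle_def cycle_def
    using walk sp False in_arcsD1 no_loops'
    by (auto simp: awalk_simps intro!: exI[of _ p])
  then have "cycle_gain \<phi> ?c = 1" using bal unfolding balanced_def by blast
  then have "\<phi> (p, q) * \<phi> (q, r) * \<phi> (r, s) * \<phi> (s, p) = 1"
    by (simp add: cycle_gain_def mult.assoc)
  then show ?thesis
    using gain_reverse[OF sp] by (metis mult.assoc mult.commute mult.right_neutral)
qed

text \<open>All walks of length 3 from \<open>p\<close> to \<open>s\<close> have the gain of the arc
  \<open>(p, s)\<close>, so the entry of \<open>A^3\<close> is their number times that gain; between
  opposite sides there are \<open>a * b\<close> of them.\<close>

lemma cube_if_balanced: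
  assumes bal: "balanced G \<phi>" and K: "complete_bipartite_digraph a b (with_proj G)"
  shows "A * A * A = of_real (real (a * b)) \<cdot>\<^sub>m A"
proof (rule A3_eqI)
  obtain X Y where V: "V = X \<union> Y" and disj: "X \<inter> Y = {}" and ab: "card X = a" "card Y = b"
    and E: "E = X \<times> Y \<union> Y \<times> X"
    using K unfolding complete_bipartite_digraph_pair_def by blast
  fix p s assume ps: "p \<in> V" "s \<in> V"
  define S where "S = {(q, r). (p, q) \<in> E \<and> (q, r) \<in> E \<and> (r, s) \<in> E}"
  have "wt p q * wt q r * wt r s = (if (q, r) \<in> S then wt p s else 0)" for q r
  proof (cases "(q, r) \<in> S")
    case True
    then have walk: "(p, q) \<in> E" "(q, r) \<in> E" "(r, s) \<in> E" by (auto simp: S_def)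
    \<comment> \<open>Three changes of side lead to the opposite side, and all arcs between the
      sides are present.\<close>
    then have "(p, s) \<in> E" using disj unfolding E by blast
    then show ?thesis using walk3_gain_if_balanced[OF bal walk] walk True by (simp add: wt_def)
  next
    case False
    then show ?thesis by (auto simp: S_def wt_def)
  qed
  then have "(\<Sum>(q, r)\<in>V \<times> V. wt p q * wt q r * wt r s)
      = (\<Sum>x\<in>V \<times> V. if x \<in> S then wt p s else 0)"
    by (intro sum.cong refl) auto
  also have "\<dots> = of_nat (card (V \<times> V \<inter> S)) * wt p s"
    using pair_finite_verts by (simp add: sum.If_cases)
  also have "V \<times> V \<inter> S = S" using in_arcsD1 in_arcsD2 by (auto simp: S_def)
  also have "of_nat (card S) * wt p s = of_real (real (a * b)) * wt p s"
  proof (cases "(p, s) \<in> E")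
    case True
    \<comment> \<open>The middle vertices are free: \<open>q\<close> ranges over the side of
      \<open>s\<close>, and \<open>r\<close> over the side of \<open>p\<close>.\<close>
    then have "S = Y \<times> X \<or> S = X \<times> Y" using disj unfolding S_def E by blast
    then have "card S = a * b" using ab by (auto simp: card_cartesian_product mult.commute)
    then show ?thesis by simp
  qed (simp add: wt_def)
  finally show "(\<Sum>(q, r)\<in>V \<times> V. wt p q * wt q r * wt r s) = of_real (real (a * b)) * wt p s" .
qed

text \<open>The constant gain 1 is balanced, so the cubic identity holds for the 0/1 adjacency
  matrix and determines its spectral radius.\<close>

lemma rho_sq:
  assumes ne: "E \<noteq> {}" and K: "complete_bipartite_digraph a b (with_proj G)"
  shows "(graph_spectral_radius G vs)\<^sup>2 = real (a * b)"
proof -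
  interpret B: enum_gain_graph G "\<lambda>_. 1" vs by (rule unit_gain)
  have "balanced G (\<lambda>_. 1)" by (simp add: balanced_def cycle_gain_def map_replicate_const)
  from B.cube_if_balanced[OF this K] show ?thesis
    unfolding graph_spectral_radius_def unit_gain_adj_mat[symmetric]
    using ne by (intro spectral_radius_sq_eqI[of _ n] B.A_hermitian B.A_nonzero B.A_carrier)
qed

end

section \<open>The bound on vertex energies and the case of equality\<close>

theorem theorem3p1:
  fixes G :: "'a pair_pre_digraph" and \<phi> :: "'a \<times> 'a \<Rightarrow> complex" and vs :: "'a list"
  assumes "gain_graph G \<phi>"
    and "Digraph_Component.connected (with_proj G)"
    and "parcs G \<noteq> {}"
    and "distinct vs" and "set vs = pverts G"
  shows "(\<forall>i < length vs.
            vertex_energy G \<phi> vs i \<ge> real (vertex_degree G (vs ! i)) / graph_spectral_radius G vs) \<and>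
         ((\<forall>i < length vs.
            vertex_energy G \<phi> vs i = real (vertex_degree G (vs ! i)) / graph_spectral_radius G vs)
          \<longleftrightarrow> balanced G \<phi> \<and> complete_bipartite_graph G)"
proof -
  interpret enum_gain_graph G \<phi> vs
    using assms by (intro enum_gain_graph.intro enum_gain_graph_axioms.intro)
  note ne = assms(3)
  note rho = rho_pos[OF ne]
  let ?P = "psd_sqrt (A * mat_adjoint A)"
  have degree: "Re ((A * A) $$ (i, i)) = vertex_degree G (vs ! i)" if "i < n" for i
    using A2_diag[OF that] by simp
  have energy: "Re (?P $$ (i, i)) = vertex_energy G \<phi> vs i" for i
    by (simp add: vertex_energy_def)
  show ?thesis
  proof (intro conjI iffI allI impI)
    fix i assume i: "i < n"
    show "vertex_energy G \<phi> vs i \<ge> vertex_degree G (vs ! i) / \<rho>"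
      using energy_ge[OF A_carrier A_hermitian _ i] eigenvalue_le_rho[OF ne] rho
      by (simp only: degree[OF i] energy pos_divide_le_eq mult.commute)
  next
    assume "\<forall>i<n. vertex_energy G \<phi> vs i = vertex_degree G (vs ! i) / \<rho>"
    \<comment> \<open>Multiplied by \<open>\<rho>\<close>, the assumption is the equality case of
      the energy bound.\<close>
    then have "A * A * A = of_real (\<rho>\<^sup>2) \<cdot>\<^sub>m A"
      using eigenvalue_le_rho[OF ne] rho
      by (intro energy_eq_imp_cube[OF A_carrier A_hermitian]) (simp_all only: degree energy, simp)
    note walk3 = walk3_if_cube[OF ne this]
    show "balanced G \<phi>" using walk3 by (intro balanced_if_walk3) blast
    show "complete_bipartite_graph G"
      using walk3 by (intro complete_bipartite_if_walk3[OF assms(2) ne]) blast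
  next
    fix i assume i: "i < n" and *: "balanced G \<phi> \<and> complete_bipartite_graph G"
    then obtain a b where K: "complete_bipartite_digraph a b (with_proj G)"
      unfolding complete_bipartite_graph_def by blast
    have "A * A * A = of_real (\<rho>\<^sup>2) \<cdot>\<^sub>m A"
      unfolding rho_sq[OF ne K] using cube_if_balanced[OF _ K] * by blast
    \<comment> \<open>The square root is \<open>A^2 / \<rho>\<close>, whose diagonal consists of the
      degrees divided by \<open>\<rho>\<close>.\<close>
    from cube_imp_psd_sqrt[OF A_carrier A_hermitian rho this]
    have "vertex_energy G \<phi> vs i = Re (of_real (1 / \<rho>) * (A * A) $$ (i, i))"
      using i unfolding energy[symmetric] by (simp del: index_mult_mat(1))
    also have "\<dots> = vertex_degree G (vs ! i) / \<rho>"
      by (simp only: A2_diag[OF i]) simp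
    finally show "vertex_energy G \<phi> vs i = vertex_degree G (vs ! i) / \<rho>" .
  qed
qed

end
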